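(* Let $n,m\ge2$. Let $\psi:\mathcal C_n\to\mathcal C_m$ be a homeomorphism preserving or reversing lexicographic order. Let $\mathcal A$ be a full $n$-ary tree-automaton with the existence property, and set $H=\mathcal D(\mathcal A)$. If $H^\psi\le F_m$, then the pullback automaton $\mathcal P_\psi(\mathcal A)$ has the existence property. Hence it is a pre-core for $H^\psi$. In particular, if $\psi$ is rational and $\mathcal A=\mathcal C(H)$ is finite and full, then folding $\mathcal P_\psi(\mathcal A)$ gives $\mathcal C(H^\psi)$, i.e. the folded quotient of $\mathcal P_\psi(\mathcal A)$ is isomorphic to the core of $H^\psi$ (no hanging trees have to be deleted).
   Context: Let $X_n=\{0,\dots,n-1\}$, $\mathcal W_n=X_n^*$ (including the empty word), $\mathcal C_n=X_n^{\mathbb N}$ with the lexicographic order, $U_u=u\mathcal C_n$. $F_n$ is the group of order-preserving homeomorphisms $f$ of $\mathcal C_n$ for which there are finite complete prefix codes $\{u_1<\dots<u_k\}$, $\{v_1<\dots<v_k\}$ in $\mathcal W_n$ (complete: cylinders partition $\mathcal C_n$) with $f(u_i\omega)=v_i\omega$. Such a pair is a tree diagram $(T_+,T_-)$ of $f$ with branch pairs $u_i\to v_i$, where $T_\pm$ are the finite full $n$-ary trees with leaf sets $\{u_i\}$, $\{v_i\}$. Each $f$ has a unique reduced tree diagram (one in which no $n$ consecutive branch pairs have the form $u0\to v0,\dots,u(n-1)\to v(n-1)$). "$f$ has the branch pair $u\to v$" means $f(u\omega)=v\omega$ for all $\omega$. $H^\psi=\{\omega\mapsto\psi(h(\psi^{-1}(\omega))):h\in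 H\}$. An $n$-ary tree-automaton is $\mathcal A=(Q,\tau,q_0)$ with root $q_0$ and partial transition function $\tau:Q\times X_n\dashrightarrow Q$ (extended to words) such that every state is reachable from the root and every state has either no outgoing transitions or one for every letter (a father state). It is full if every state is a father state. A tree diagram with branch pairs $u_i\to v_i$ is accepted if $\tau(q_0,u_i)$, $\tau(q_0,v_i)$ are defined and equal for all $i$; $\mathcal D(\mathcal A)$ is the subgroup of elements of $F_n$ with at least one accepted tree diagram. $\mathcal A$ has the existence property if whenever $\tau(q_0,u)$ and $\tau(q_0,v)$ are defined and equal, some element of $\mathcal D(\mathcal A)$ has the branch pair $u\to v$. A pre-core for a subgroup $K\le F_n$ is a tree-automaton $\mathcal A$ with $\mathcal D(\mathcal A)=K$ and with the existence property. $\mathcal A$ is folded if no two distinct father states have the same ordered list of children; the folded quotient of $\mathcal A$ is its quotient by the smallest automaton congruence (equivalence relation on states compatible with transitions) for which the quotient is folded; equivalently, repeatedly identify father states with identical ordered lists of children. Core: for $H\le F_n$ generated by a set $S$, take for each $s\in S$ its reduced tree diagram, view both trees as rooted graphs with edges directed away from the root and labelled $0,\dots,n-1$ from left to right, identify the two roots and identify the $i$-th leaf of $T_+$ with the $i$-th leaf of $T_-$ for every $i$; identify the roots over all $s\in S$. Take the quotient by the smallest equivalence relation such that each vertex has at most one outgoing edge with each label and no two distinct father states have the same ordered list of children. The result is the core $\mathcal C(H)$ (independent of $S$); it has the existence property. For a continuous injective $f:\mathcal C_m\to\mathcal C_n$ and $x\in\mathcal W_m$, $\theta_f(x)$ is the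 greatest common prefix of $f(U_x)$ and the local action $f_x$ is defined by $f(x\omega)=\theta_f(x)f_x(\omega)$. A homeomorphism is rational if it has finitely many local actions (equivalently, is represented by a finite transducer). Put $\phi=\psi^{-1}$ and let $T^\phi=(S_\phi,t_\phi,o_\phi,s_\phi)$ with $S_\phi=\{\phi_x:x\in\mathcal W_m\}$, $s_\phi=\phi$, $t_\phi(f,a)=f_a$, $o_\phi(f,a)=\theta_f(a)$. The pullback automaton $\mathcal P_\psi(\mathcal A)$ is the part reachable from the root of the $m$-ary automaton with state set $S_\phi\times Q$, root $(s_\phi,q_0)$, and transitions $(s,q)\cdot a=\bigl(t_\phi(s,a),\tau(q,o_\phi(s,a))\bigr)$, $a\in X_m$. *)

theory Defs
  imports
    "HOL-Analysis.Analysis"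
    "HOL-Algebra.Bij"
    "HOL-Algebra.Generated_Groups"
    "HOL-Library.Sublist"
    "HOL-Library.List_Lexorder"
    "HOL-Library.Fun_Lexorder"
    "HOL-Library.Omega_Words_Fun"
begin

section \<open>Words and Cantor spaces\<close>

text \<open>
  The alphabet \<open>X\<^sub>n\<close> is \<open>{..<n}\<close>. Infinite words are functions \<open>nat \<Rightarrow> nat\<close>; the type-class
  topology on this type is the product of discrete topologies, so \<open>cantor n\<close> carries the
  usual Cantor topology as a subspace. The lexicographic order on infinite words is
  \<^const>\<open>less_fun\<close>, the one on finite words is the order of \<^theory>\<open>HOL-Library.List_Lexorder\<close>.
\<close>

definition words :: "nat \<Rightarrow> nat list set" where
  "words n = lists {..<n}"

definition cantor :: "nat \<Rightarrow> (nat \<Rightarrow> nat) set" where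
  "cantor n = {\<omega>. \<forall>i. \<omega> i < n}"

definition cylinder :: "nat \<Rightarrow> nat list \<Rightarrow> (nat \<Rightarrow> nat) set" where
  "cylinder n u = (\<lambda>\<omega>. u \<frown> \<omega>) ` cantor n"

definition complete_prefix_code :: "nat \<Rightarrow> nat list set \<Rightarrow> bool" where
  "complete_prefix_code n U \<longleftrightarrow>
     finite U \<and> U \<subseteq> words n \<and>
     (\<forall>u\<in>U. \<forall>v\<in>U. Sublist.prefix u v \<longrightarrow> u = v) \<and>
     (\<Union>u\<in>U. cylinder n u) = cantor n"

section \<open>The Higman--Thompson group\<close>

text \<open>
  A tree diagram is given by the list of its branch pairs, in left-to-right order.
\<close>

type_synonym diagram = "(nat list \<times> nat list) list"

definition tree_diagram :: "nat \<Rightarrow> diagram \<Rightarrow> bool" where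
  "tree_diagram n d \<longleftrightarrow>
     complete_prefix_code n (fst ` set d) \<and> sorted_wrt (<) (map fst d) \<and>
     complete_prefix_code n (snd ` set d) \<and> sorted_wrt (<) (map snd d)"

definition has_branch_pair ::
  "nat \<Rightarrow> ((nat \<Rightarrow> nat) \<Rightarrow> (nat \<Rightarrow> nat)) \<Rightarrow> nat list \<Rightarrow> nat list \<Rightarrow> bool" where
  "has_branch_pair n f u v \<longleftrightarrow> (\<forall>\<omega>\<in>cantor n. f (u \<frown> \<omega>) = v \<frown> \<omega>)"

definition tree_diagram_of ::
  "nat \<Rightarrow> ((nat \<Rightarrow> nat) \<Rightarrow> (nat \<Rightarrow> nat)) \<Rightarrow> diagram \<Rightarrow> bool" where
  "tree_diagram_of n f d \<longleftrightarrow>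
     tree_diagram n d \<and> (\<forall>(u, v)\<in>set d. has_branch_pair n f u v)"

definition reduced_diagram :: "nat \<Rightarrow> diagram \<Rightarrow> bool" where
  "reduced_diagram n d \<longleftrightarrow>
     \<not> (\<exists>i u v. i + n \<le> length d \<and> (\<forall>a<n. d ! (i + a) = (u @ [a], v @ [a])))"

text \<open>
  Maps of \<open>cantor n\<close> are taken extensional, as in \<^const>\<open>BijGroup\<close>, so that equality of group
  elements is equality of functions on \<open>cantor n\<close>.
\<close>

definition thompson :: "nat \<Rightarrow> ((nat \<Rightarrow> nat) \<Rightarrow> (nat \<Rightarrow> nat)) set" where
  "thompson n = {f \<in> extensional (cantor n).
     (\<exists>g. homeomorphism (cantor n) (cantor n) f g) \<and>
     monotone_on (cantor n) less_fun less_fun f \<and>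
     (\<exists>d. tree_diagram_of n f d)}"

definition thompson_group :: "nat \<Rightarrow> ((nat \<Rightarrow> nat) \<Rightarrow> (nat \<Rightarrow> nat)) monoid" where
  "thompson_group n = (BijGroup (cantor n))\<lparr>carrier := thompson n\<rparr>"

definition generates :: "nat \<Rightarrow> ((nat \<Rightarrow> nat) \<Rightarrow> (nat \<Rightarrow> nat)) set \<Rightarrow>
    ((nat \<Rightarrow> nat) \<Rightarrow> (nat \<Rightarrow> nat)) set \<Rightarrow> bool" where
  "generates n S H \<longleftrightarrow> S \<subseteq> thompson n \<and> generate (thompson_group n) S = H"

section \<open>Tree-automata\<close>

text \<open>
  Only transitions from elements of \<open>states\<close> along letters \<open>a < n\<close> are meaningful.
\<close>

record 'q automaton =
  states :: "'q set"
  trans :: "'q \<Rightarrow> nat \<Rightarrow> 'q option"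
  root :: 'q

fun run :: "'q automaton \<Rightarrow> 'q \<Rightarrow> nat list \<Rightarrow> 'q option" where
  "run A q [] = Some q"
| "run A q (a # w) = Option.bind (trans A q a) (\<lambda>q'. run A q' w)"

definition father_state :: "nat \<Rightarrow> 'q automaton \<Rightarrow> 'q \<Rightarrow> bool" where
  "father_state n A q \<longleftrightarrow> (\<forall>a<n. trans A q a \<noteq> None)"

definition tree_automaton :: "nat \<Rightarrow> 'q automaton \<Rightarrow> bool" where
  "tree_automaton n A \<longleftrightarrow>
     root A \<in> states A \<and>
     (\<forall>q\<in>states A. \<forall>a<n. \<forall>q'. trans A q a = Some q' \<longrightarrow> q' \<in> states A) \<and>
     (\<forall>q\<in>states A. \<exists>w\<in>words n. run A (root A) w = Some q) \<and>
     (\<forall>q\<in>states A. (\<forall>a<n. trans A q a = None) \<or> father_state n A q)"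

definition full :: "nat \<Rightarrow> 'q automaton \<Rightarrow> bool" where
  "full n A \<longleftrightarrow> (\<forall>q\<in>states A. father_state n A q)"

definition same_state :: "'q automaton \<Rightarrow> nat list \<Rightarrow> nat list \<Rightarrow> bool" where
  "same_state A u v \<longleftrightarrow> (\<exists>q. run A (root A) u = Some q \<and> run A (root A) v = Some q)"

definition accepted :: "'q automaton \<Rightarrow> diagram \<Rightarrow> bool" where
  "accepted A d \<longleftrightarrow> (\<forall>(u, v)\<in>set d. same_state A u v)"

definition diagram_group :: "nat \<Rightarrow> 'q automaton \<Rightarrow> ((nat \<Rightarrow> nat) \<Rightarrow> (nat \<Rightarrow> nat)) set" where
  "diagram_group n A = {f \<in> thompson n. \<exists>d. tree_diagram_of n f d \<and> accepted A d}"

definition existence_property :: "nat \<Rightarrow> 'q automaton \<Rightarrow> bool" where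
  "existence_property n A \<longleftrightarrow>
     (\<forall>u\<in>words n. \<forall>v\<in>words n. same_state A u v \<longrightarrow>
        (\<exists>f\<in>diagram_group n A. has_branch_pair n f u v))"

definition pre_core ::
  "nat \<Rightarrow> 'q automaton \<Rightarrow> ((nat \<Rightarrow> nat) \<Rightarrow> (nat \<Rightarrow> nat)) set \<Rightarrow> bool" where
  "pre_core n A K \<longleftrightarrow>
     subgroup K (thompson_group n) \<and> tree_automaton n A \<and>
     diagram_group n A = K \<and> existence_property n A"

definition automaton_iso :: "nat \<Rightarrow> 'p automaton \<Rightarrow> 'q automaton \<Rightarrow> bool" where
  "automaton_iso n A B \<longleftrightarrow>
     (\<exists>g. bij_betw g (states A) (states B) \<and> g (root A) = root B \<and>
        (\<forall>q\<in>states A. \<forall>a<n. trans B (g q) a = map_option g (trans A q a)))"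

section \<open>Folding and the core\<close>

text \<open>
  Folding is defined for rooted graphs with labelled edges, which need not be deterministic,
  since the core is a quotient of such a graph. The smallest admissible relation is the
  intersection of all admissible ones; the set of these is nonempty (it contains \<open>V \<times> V\<close>).
\<close>

definition quotient_edges ::
  "('v \<times> nat \<times> 'v) set \<Rightarrow> ('v \<times> 'v) set \<Rightarrow> ('v set \<times> nat \<times> 'v set) set" where
  "quotient_edges E R = {(R `` {x}, a, R `` {y}) | x a y. (x, a, y) \<in> E}"

definition deterministic_edges :: "('v \<times> nat \<times> 'v) set \<Rightarrow> bool" where
  "deterministic_edges E \<longleftrightarrow>
     (\<forall>x a y z. (x, a, y) \<in> E \<longrightarrow> (x, a, z) \<in> E \<longrightarrow> y = z)"

definition father_vertex :: "nat \<Rightarrow> ('v \<times> nat \<times> 'v) set \<Rightarrow> 'v \<Rightarrow> bool" where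
  "father_vertex n E x \<longleftrightarrow> (\<forall>a<n. \<exists>y. (x, a, y) \<in> E)"

definition folded_edges :: "nat \<Rightarrow> ('v \<times> nat \<times> 'v) set \<Rightarrow> bool" where
  "folded_edges n E \<longleftrightarrow>
     (\<forall>x y. father_vertex n E x \<longrightarrow> father_vertex n E y \<longrightarrow>
        (\<forall>a<n. \<forall>z. (x, a, z) \<in> E \<longleftrightarrow> (y, a, z) \<in> E) \<longrightarrow> x = y)"

definition folding_relation ::
  "nat \<Rightarrow> 'v set \<Rightarrow> ('v \<times> nat \<times> 'v) set \<Rightarrow> ('v \<times> 'v) set \<Rightarrow> ('v \<times> 'v) set" where
  "folding_relation n V E I =
     \<Inter> {R. equiv V R \<and> I \<subseteq> R \<and>
           deterministic_edges (quotient_edges E R) \<and> folded_edges n (quotient_edges E R)}"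

definition quotient_automaton ::
  "'v set \<Rightarrow> ('v \<times> nat \<times> 'v) set \<Rightarrow> 'v \<Rightarrow> ('v \<times> 'v) set \<Rightarrow> 'v set automaton" where
  "quotient_automaton V E r R =
     \<lparr>states = V // R,
      trans = (\<lambda>X a. if \<exists>Y. (X, a, Y) \<in> quotient_edges E R
                     then Some (THE Y. (X, a, Y) \<in> quotient_edges E R) else None),
      root = R `` {r}\<rparr>"

definition automaton_edges :: "nat \<Rightarrow> 'q automaton \<Rightarrow> ('q \<times> nat \<times> 'q) set" where
  "automaton_edges n A = {(p, a, q). p \<in> states A \<and> a < n \<and> trans A p a = Some q}"

text \<open>
  For the graph of an automaton, determinism of the quotient says that the equivalence is
  compatible with transitions, i.e. is an automaton congruence.
\<close>

definition folded_quotient :: "nat \<Rightarrow> 'q automaton \<Rightarrow> 'q set automaton" where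
  "folded_quotient n A =
     quotient_automaton (states A) (automaton_edges n A) (root A)
       (folding_relation n (states A) (automaton_edges n A) {})"

text \<open>
  The vertices of the two trees of a diagram are the prefixes of their leaves. The trees of all
  diagrams are made disjoint by tags; the extra vertex \<open>Base\<close>, identified with all roots,
  ensures that the core of an empty generating set is a single root.
\<close>

datatype core_vertex = Base | Source diagram "nat list" | Target diagram "nat list"

definition reduced_diagrams :: "nat \<Rightarrow> ((nat \<Rightarrow> nat) \<Rightarrow> (nat \<Rightarrow> nat)) set \<Rightarrow> diagram set" where
  "reduced_diagrams n S = {d. reduced_diagram n d \<and> (\<exists>s\<in>S. tree_diagram_of n s d)}"

definition tree_vertices :: "nat list set \<Rightarrow> nat list set" where
  "tree_vertices U = {w. \<exists>u\<in>U. Sublist.prefix w u}"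

definition core_vertices :: "diagram set \<Rightarrow> core_vertex set" where
  "core_vertices D =
     {Base} \<union>
     {Source d w | d w. d \<in> D \<and> w \<in> tree_vertices (fst ` set d)} \<union>
     {Target d w | d w. d \<in> D \<and> w \<in> tree_vertices (snd ` set d)}"

definition core_edges :: "diagram set \<Rightarrow> (core_vertex \<times> nat \<times> core_vertex) set" where
  "core_edges D =
     {(Source d w, a, Source d (w @ [a])) | d w a.
        d \<in> D \<and> w @ [a] \<in> tree_vertices (fst ` set d)} \<union>
     {(Target d w, a, Target d (w @ [a])) | d w a.
        d \<in> D \<and> w @ [a] \<in> tree_vertices (snd ` set d)}"

definition core_identifications :: "diagram set \<Rightarrow> (core_vertex \<times> core_vertex) set" where
  "core_identifications D =
     {(Base, Source d []) | d. d \<in> D} \<union>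
     {(Base, Target d []) | d. d \<in> D} \<union>
     {(Source d u, Target d v) | d u v. d \<in> D \<and> (u, v) \<in> set d}"

definition core :: "nat \<Rightarrow> ((nat \<Rightarrow> nat) \<Rightarrow> (nat \<Rightarrow> nat)) set \<Rightarrow> core_vertex set automaton" where
  "core n S = (let D = reduced_diagrams n S in
     quotient_automaton (core_vertices D) (core_edges D) Base
       (folding_relation n (core_vertices D) (core_edges D) (core_identifications D)))"

section \<open>Local actions and the pullback automaton\<close>

definition common_prefix :: "nat list \<Rightarrow> (nat \<Rightarrow> nat) set \<Rightarrow> bool" where
  "common_prefix u X \<longleftrightarrow> (\<forall>\<xi>\<in>X. \<exists>\<omega>. \<xi> = u \<frown> \<omega>)"

definition greatest_common_prefix :: "(nat \<Rightarrow> nat) set \<Rightarrow> nat list" where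
  "greatest_common_prefix X =
     (THE u. common_prefix u X \<and> (\<forall>v. common_prefix v X \<longrightarrow> Sublist.prefix v u))"

definition local_prefix ::
  "nat \<Rightarrow> ((nat \<Rightarrow> nat) \<Rightarrow> (nat \<Rightarrow> nat)) \<Rightarrow> nat list \<Rightarrow> nat list" where
  "local_prefix m f x = greatest_common_prefix (f ` cylinder m x)"

text \<open>
  Deleting the first \<open>length (local_prefix m f x)\<close> letters of \<open>f (x \<frown> \<omega>)\<close> gives the unique
  solution of \<open>f (x \<frown> \<omega>) = local_prefix m f x \<frown> local_action m f x \<omega>\<close>. Local actions
  are restricted to \<open>cantor m\<close> so that they can be compared as functions there.
\<close>

definition local_action ::
  "nat \<Rightarrow> ((nat \<Rightarrow> nat) \<Rightarrow> (nat \<Rightarrow> nat)) \<Rightarrow> nat list \<Rightarrow> ((nat \<Rightarrow> nat) \<Rightarrow> (nat \<Rightarrow> nat))" where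
  "local_action m f x =
     (\<lambda>\<omega>\<in>cantor m. Omega_Words_Fun.suffix (length (local_prefix m f x)) (f (x \<frown> \<omega>)))"

definition rational :: "nat \<Rightarrow> ((nat \<Rightarrow> nat) \<Rightarrow> (nat \<Rightarrow> nat)) \<Rightarrow> bool" where
  "rational n f \<longleftrightarrow> finite (local_action n f ` words n)"

text \<open>
  In the following, \<open>\<psi>\<close> is a homeomorphism from \<open>cantor n\<close> onto \<open>cantor m\<close>.
\<close>

definition cantor_inverse ::
  "nat \<Rightarrow> nat \<Rightarrow> ((nat \<Rightarrow> nat) \<Rightarrow> (nat \<Rightarrow> nat)) \<Rightarrow> ((nat \<Rightarrow> nat) \<Rightarrow> (nat \<Rightarrow> nat))" where
  "cantor_inverse n m \<psi> = restrict (inv_into (cantor n) \<psi>) (cantor m)"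

definition conjugate_group ::
  "nat \<Rightarrow> nat \<Rightarrow> ((nat \<Rightarrow> nat) \<Rightarrow> (nat \<Rightarrow> nat)) \<Rightarrow> ((nat \<Rightarrow> nat) \<Rightarrow> (nat \<Rightarrow> nat)) set \<Rightarrow>
    ((nat \<Rightarrow> nat) \<Rightarrow> (nat \<Rightarrow> nat)) set" where
  "conjugate_group n m \<psi> H = (\<lambda>h. \<lambda>\<omega>\<in>cantor m. \<psi> (h (cantor_inverse n m \<psi> \<omega>))) ` H"

definition product_automaton :: "nat \<Rightarrow> nat \<Rightarrow> ((nat \<Rightarrow> nat) \<Rightarrow> (nat \<Rightarrow> nat)) \<Rightarrow> 'q automaton \<Rightarrow>
    (((nat \<Rightarrow> nat) \<Rightarrow> (nat \<Rightarrow> nat)) \<times> 'q) automaton" where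
  "product_automaton n m \<psi> A =
     \<lparr>states = (local_action m (cantor_inverse n m \<psi>) ` words m) \<times> states A,
      trans = (\<lambda>(s, q) a.
        map_option (\<lambda>q'. (local_action m s [a], q')) (run A q (local_prefix m s [a]))),
      root = (cantor_inverse n m \<psi>, root A)\<rparr>"

definition reachable_part :: "nat \<Rightarrow> 'q automaton \<Rightarrow> 'q automaton" where
  "reachable_part n A =
     A\<lparr>states := {q \<in> states A. \<exists>w\<in>words n. run A (root A) w = Some q}\<rparr>"

definition pullback :: "nat \<Rightarrow> nat \<Rightarrow> ((nat \<Rightarrow> nat) \<Rightarrow> (nat \<Rightarrow> nat)) \<Rightarrow> 'q automaton \<Rightarrow>
    (((nat \<Rightarrow> nat) \<Rightarrow> (nat \<Rightarrow> nat)) \<times> 'q) automaton" where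
  "pullback n m \<psi> A = reachable_part m (product_automaton n m \<psi> A)"

end

(*
  A map is in the diagram group of a full automaton as soon as every point of the Cantor space lies
  in the cylinder of an accepted branch pair; by the fan theorem, finitely many of them suffice.
  In this pointwise form, acceptance passes through psi: if h sends the cylinder of theta(x) to that
  of theta(y) and phi_x = phi_y, then psi h phi sends the cylinder of x to that of y. This gives
  D(P) = H^psi and the existence property of the pullback P.

  For the core of K = D(P), with P finite and full: folding P identifies two states iff all
  sufficiently long words lead from them to the same state. Send each vertex of the trees of the
  generators to the state of P reached by its word. The pulled back equivalence is admissible for
  the core. It is the least one: if two words reach equivalent states of P, then their long
  extensions are exchanged by elements of K, which every folded quotient of the trees accepts, so
  the words reach the same vertex there. No vertex of such a quotient lacks an edge, because below
  it infinitely many words would have to reach pairwise different states of P.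
*)

theory Submission
  imports Defs
begin

text \<open>\<open>\<psi>\<close> need not map cylinders to cylinders, so the leaves of a diagram of
  \<open>h\<close> and of a diagram of its conjugate are unrelated. Whole diagrams are therefore
  never transported, only branch pairs around a given point, once the source word is long enough.
  This works because acceptance survives every extension of a branch pair, which is what fullness
  provides. The same scheme is used for acceptance by a folded quotient of the trees of the
  generators. Such a quotient might lack edges, and then extension would break down; infinite trees
  hung onto the gaps restore it, and only afterwards are the gaps excluded. An element with a given
  branch pair may have only finer accepted diagrams. Hence equalities between states are first
  obtained after long extensions, and foldedness brings them back to the original words. The states
  of the pullback involve local actions of \<open>\<phi>\<close>, while rationality is assumed for
  \<open>\<psi>\<close>; finiteness thus needs a proof that the inverse is rational. The order
  hypothesis serves to bring \<open>\<phi> g \<psi>\<close> back into the Thompson group: an order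
  reversed by \<open>\<psi>\<close> is reversed again by \<open>\<phi>\<close>.\<close>

declare build_cons [simp del] build_append [simp del]

section \<open>Words, cylinders and the fan theorem\<close>

abbreviation initial :: "nat \<Rightarrow> (nat \<Rightarrow> 'a) \<Rightarrow> 'a list" where
  "initial k \<omega> \<equiv> subsequence \<omega> 0 k"

lemma words_Nil [simp]: "[] \<in> words n"
  by (simp add: words_def)

lemma words_Cons [simp]: "a # u \<in> words n \<longleftrightarrow> a < n \<and> u \<in> words n"
  by (simp add: words_def)

lemma words_append [simp]: "u @ v \<in> words n \<longleftrightarrow> u \<in> words n \<and> v \<in> words n"
  by (simp add: words_def)

lemma replicate_in_words: "a < n \<Longrightarrow> replicate k a \<in> words n"
  by (auto simp: words_def lists_eq_set)

lemma conc_in_cantor [simp]: "u \<frown> \<omega> \<in> cantor n \<longleftrightarrow> u \<in> words n \<and> \<omega> \<in> cantor n"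
proof -
  have "u \<frown> \<omega> \<in> cantor n \<longleftrightarrow> range (u \<frown> \<omega>) \<subseteq> {..<n}"
    unfolding cantor_def image_subset_iff by simp
  also have "\<dots> \<longleftrightarrow> u \<in> words n \<and> \<omega> \<in> cantor n"
    unfolding range_conc by (auto simp: cantor_def words_def lists_eq_set)
  finally show ?thesis .
qed

lemma suffix_in_cantor [simp]: "\<omega> \<in> cantor n \<Longrightarrow> Omega_Words_Fun.suffix k \<omega> \<in> cantor n"
  by (simp add: cantor_def)

lemma initial_in_words [simp]: "\<omega> \<in> cantor n \<Longrightarrow> initial k \<omega> \<in> words n"
  by (auto simp: cantor_def words_def lists_eq_set)

lemma zero_in_cantor: "2 \<le> n \<Longrightarrow> (\<lambda>_. 0) \<in> cantor n"
  by (simp add: cantor_def)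

lemma initial_eq_conc:
  assumes "initial (length u) \<eta> = u"
  shows "\<eta> = u \<frown> Omega_Words_Fun.suffix (length u) \<eta>"
proof -
  have "\<eta> = initial (length u) \<eta> \<frown> Omega_Words_Fun.suffix (length u) \<eta>"
    by (rule prefix_suffix)
  then show ?thesis by (simp only: assms)
qed

lemma mem_cylinder_iff:
  assumes "u \<in> words n"
  shows "\<omega> \<in> cylinder n u \<longleftrightarrow> \<omega> \<in> cantor n \<and> initial (length u) \<omega> = u"
proof
  assume "\<omega> \<in> cylinder n u"
  then show "\<omega> \<in> cantor n \<and> initial (length u) \<omega> = u"
    using assms by (auto simp: cylinder_def)
next
  assume *: "\<omega> \<in> cantor n \<and> initial (length u) \<omega> = u"
  then have "\<omega> = u \<frown> Omega_Words_Fun.suffix (length u) \<omega>"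
    using initial_eq_conc by blast
  then show "\<omega> \<in> cylinder n u"
    unfolding cylinder_def using * by (blast intro: suffix_in_cantor)
qed

lemma initial_mono_eq:
  assumes "initial k \<omega> = initial k \<eta>" and "j \<le> k"
  shows "initial j \<omega> = initial j \<eta>"
  using arg_cong[OF assms(1), of "take j"] assms(2) by (simp add: min_absorb1)

text \<open>Koenig's lemma for an extension-closed bar. A word is \<open>bad\<close> if no length
  bound works below it. A bad word has a bad child, since finitely many bounds below the children
  combine into one; a bad empty word would thus start an infinite path of bad words, which the bar
  must meet.\<close>

lemma cantor_fan:
  assumes bar: "\<And>\<omega>. \<omega> \<in> cantor n \<Longrightarrow> \<exists>k. Q (initial k \<omega>)"
    and ext: "\<And>w a. Q w \<Longrightarrow> w \<in> words n \<Longrightarrow> a < n \<Longrightarrow> Q (w @ [a])"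
  obtains N where "\<And>w. w \<in> words n \<Longrightarrow> N \<le> length w \<Longrightarrow> Q w"
proof -
  have ext': "Q w \<Longrightarrow> w \<in> words n \<Longrightarrow> v \<in> words n \<Longrightarrow> Q (w @ v)" for w v
  proof (induction v rule: rev_induct)
    case (snoc a v)
    then show ?case using ext[of "w @ v" a] by simp
  qed simp
  define bad where "bad w \<longleftrightarrow> w \<in> words n \<and>
      \<not> (\<exists>N. \<forall>v\<in>words n. N \<le> length v \<longrightarrow> Q (w @ v))" for w
  have step: "\<exists>a<n. bad (w @ [a])" if "bad w" for w
  proof (rule ccontr)
    assume "\<not> (\<exists>a<n. bad (w @ [a]))"
    then have "\<forall>a<n. \<exists>N. \<forall>v\<in>words n. N \<le> length v \<longrightarrow> Q (w @ a # v)"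
      using that by (auto simp: bad_def)
    then obtain N where N: "\<And>a v. a < n \<Longrightarrow> v \<in> words n \<Longrightarrow> N a \<le> length v \<Longrightarrow> Q (w @ a # v)"
      by metis
    \<comment> \<open>The sum dominates the bound of each child, and \<open>Suc\<close> accounts for
      the letter leading to it.\<close>
    define M where "M = Suc (\<Sum>a<n. N a)"
    have "Q (w @ v)" if v: "v \<in> words n" "M \<le> length v" for v
    proof -
      obtain a v' where v': "v = a # v'" "a < n" "v' \<in> words n"
        using v by (cases v) (auto simp: M_def)
      have "N a \<le> (\<Sum>a<n. N a)" using v' by (intro member_le_sum) auto
      then show ?thesis using N[of a v'] v v' by (simp add: M_def)
    qed
    then show False using that by (auto simp: bad_def)
  qed
  have "\<not> bad []"
  proof
    assume "bad []"
    have "\<exists>s. \<forall>k. bad (s k) \<and> length (s k) = k \<and> (\<exists>a<n. s (Suc k) = s k @ [a])"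
    proof -
      have "\<exists>s. \<forall>k. (bad (s k) \<and> length (s k) = k) \<and> (\<exists>a<n. s (Suc k) = s k @ [a])"
      proof (rule dependent_nat_choice)
        show "\<exists>x. bad x \<and> length x = 0" using \<open>bad []\<close> by simp
        show "\<exists>y. (bad y \<and> length y = Suc k) \<and> (\<exists>a<n. y = x @ [a])"
          if "bad x \<and> length x = k" for x k
          using step[of x] that by auto
      qed
      then show ?thesis by simp
    qed
    then obtain s where s: "\<And>k. bad (s k)" "\<And>k. length (s k) = k"
      "\<And>k. \<exists>a<n. s (Suc k) = s k @ [a]" by blast
    define \<omega> where "\<omega> k = s (Suc k) ! k" for k
    have "s (Suc k) = s k @ [\<omega> k] \<and> \<omega> k < n" for k
      using s(3)[of k] s(2)[of k] by (auto simp: \<omega>_def nth_append)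
    note \<omega> = this
    have "initial k \<omega> = s k" for k
    proof (induction k)
      case 0 then show ?case using s(2)[of 0] by simp
    next
      case (Suc k) then show ?case using \<omega>[of k] by simp
    qed
    moreover have "\<omega> \<in> cantor n" using \<omega> by (simp add: cantor_def)
    ultimately obtain k where "Q (s k)" using bar[of \<omega>] by auto
    then show False using s(1)[of k] ext' unfolding bad_def by blast
  qed
  then show thesis using that by (auto simp: bad_def)
qed

text \<open>Continuity in terms of prefixes: a basic open set of the product topology restricts only
  finitely many coordinates, and \<open>N\<close> bounds their indices.\<close>

lemma continuous_on_cantor_initial:
  fixes f :: "(nat \<Rightarrow> nat) \<Rightarrow> (nat \<Rightarrow> nat)"
  assumes "continuous_on (cantor m) f" and "\<omega> \<in> cantor m"
  obtains N where
    "\<And>\<eta>. \<eta> \<in> cantor m \<Longrightarrow> initial N \<eta> = initial N \<omega> \<Longrightarrow> initial k (f \<eta>) = initial k (f \<omega>)"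
proof -
  define V where "V = {\<eta> :: nat \<Rightarrow> nat. \<forall>i\<in>{..<k}. \<eta> i \<in> {f \<omega> i}}"
  have "open V"
    unfolding V_def by (rule product_topology_basis') (auto intro: open_discrete)
  then obtain U where U: "open U" "U \<inter> cantor m = f -` V \<inter> cantor m"
    using assms(1) unfolding continuous_on_open_invariant by metis
  have "\<omega> \<in> U" using U assms(2) by (auto simp: V_def)
  have "openin (product_topology (\<lambda>_. euclidean) UNIV) U"
    using \<open>open U\<close> by (simp add: open_fun_def)
  then obtain X where X: "\<omega> \<in> Pi\<^sub>E UNIV X" "finite {i. X i \<noteq> UNIV}" "Pi\<^sub>E UNIV X \<subseteq> U"
    using product_topology_open_contains_basis[of "\<lambda>_. euclidean" UNIV U \<omega>] \<open>\<omega> \<in> U\<close>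
    by (metis topspace_euclidean)
  obtain N where N: "\<And>i. X i \<noteq> UNIV \<Longrightarrow> i < N"
    using X(2) finite_nat_set_iff_bounded by auto
  show thesis
  proof (rule that)
    fix \<eta> assume \<eta>: "\<eta> \<in> cantor m" "initial N \<eta> = initial N \<omega>"
    have "\<eta> i = \<omega> i" if "i < N" for i
      using arg_cong[OF \<eta>(2), of "\<lambda>w. w ! i"] that by simp
    then have "\<eta> \<in> Pi\<^sub>E UNIV X"
      using X(1) N by (auto simp: PiE_iff) (metis UNIV_I)
    then have "\<eta> \<in> f -` V" using X(3) U(2) \<eta>(1) by blast
    then show "initial k (f \<eta>) = initial k (f \<omega>)"
      by (intro nth_equalityI) (auto simp: V_def)
  qed
qed

lemma less_fun_linear:
  fixes f g :: "nat \<Rightarrow> 'a::linorder"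
  shows "f \<noteq> g \<Longrightarrow> less_fun f g \<or> less_fun g f"
proof -
  assume "f \<noteq> g"
  define k where "k = (LEAST k. f k \<noteq> g k)"
  obtain j where "f j \<noteq> g j" using \<open>f \<noteq> g\<close> by blast
  then have "f k \<noteq> g k" unfolding k_def by (rule LeastI)
  moreover have "f i = g i" if "i < k" for i
    using that not_less_Least unfolding k_def by blast
  ultimately show ?thesis unfolding less_fun_def by (metis linorder_neqE)
qed

text \<open>The target relation is left general so that the lemma covers order-preserving and
  order-reversing maps alike.\<close>

lemma monotone_on_reflect:
  fixes f :: "(nat \<Rightarrow> nat) \<Rightarrow> 'b"
  assumes "monotone_on X less_fun r f" "x \<in> X" "y \<in> X" "r (f x) (f y)"
    and asym: "\<And>a b. r a b \<Longrightarrow> \<not> r b a"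
  shows "less_fun x y"
proof (rule ccontr)
  assume "\<not> less_fun x y"
  moreover have "x \<noteq> y" using assms(4) asym by blast
  ultimately have "less_fun y x" using less_fun_linear by blast
  then have "r (f y) (f x)" by (rule monotone_onD[OF assms(1,3,2)])
  then show False using assms(4) asym by blast
qed

lemma monotone_on_inverse:
  fixes f :: "(nat \<Rightarrow> nat) \<Rightarrow> (nat \<Rightarrow> nat)"
  assumes mono: "monotone_on X less_fun less_fun f" and gX: "g ` Y \<subseteq> X"
    and fg: "\<And>y. y \<in> Y \<Longrightarrow> f (g y) = y"
  shows "monotone_on Y less_fun less_fun g"
proof (rule monotone_onI)
  fix x y assume xy: "x \<in> Y" "y \<in> Y" "less_fun x y"
  then have "g x \<in> X" "g y \<in> X" "less_fun (f (g x)) (f (g y))" using gX fg by auto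
  then show "less_fun (g x) (g y)" by (rule monotone_on_reflect[OF mono _ _ _ less_fun_asym])
qed

text \<open>In the order on lists a word precedes its own extensions, which says nothing about their
  cylinders. Without that case the comparison is decided at a common position and does not see the
  tails.\<close>

lemma less_fun_conc:
  fixes u v :: "nat list"
  assumes "u < v" "\<not> Sublist.prefix u v"
  shows "less_fun (u \<frown> \<omega>) (v \<frown> \<eta>)"
proof -
  have "(u, v) \<in> lexord {(u, v). u < v}" using assms(1) by (simp add: list_less_def)
  moreover have "\<not> (length u < length v \<and> take (length u) v = u)"
    using assms(2) by (metis take_is_prefix)
  ultimately obtain i where i: "i < min (length u) (length v)" "take i u = take i v" "u ! i < v ! i"
    unfolding lexord_take_index_conv by auto
  have "u ! j = v ! j" if "j < i" for j
    using i(2) that by (metis nth_take)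
  then show ?thesis
    using i by (intro less_funI exI[of _ i]) (auto simp: conc_def)
qed

section \<open>Branch pairs and tree diagrams\<close>

lemma conc_eq_comparable:
  assumes "u \<frown> \<omega> = v \<frown> \<eta>"
  shows "Sublist.prefix u v \<or> Sublist.prefix v u"
proof -
  have "take k u = take k v" if "k \<le> length u" "k \<le> length v" for k
    using arg_cong[OF assms, of "initial k"] that by simp
  note * = this
  show ?thesis
  proof (cases "length u \<le> length v")
    case True
    then have "u = take (length u) v" using *[of "length u"] by simp
    then show ?thesis using take_is_prefix[of "length u" v] by simp
  next
    case False
    then have "v = take (length v) u" using *[of "length v"] by simp
    then show ?thesis using take_is_prefix[of "length v" u] by simp
  qed
qed

text \<open>If one word were longer, it would prescribe a letter that is still free on the other
  side. The constant sequences 0 and 1 refute this, which is where two letters are needed.\<close>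

lemma conc_cancel:
  assumes "2 \<le> n" and eq: "\<And>\<omega>. \<omega> \<in> cantor n \<Longrightarrow> u \<frown> \<omega> = v \<frown> \<omega>"
  shows "u = v"
proof -
  have *: "\<not> length p < length q"
    if "\<And>\<omega>. \<omega> \<in> cantor n \<Longrightarrow> p \<frown> \<omega> = q \<frown> \<omega>" for p q :: "nat list"
  proof
    assume "length p < length q"
    then have "\<omega> 0 = q ! length p" if "\<omega> \<in> cantor n" for \<omega>
      using fun_cong[OF \<open>\<And>\<omega>. \<omega> \<in> cantor n \<Longrightarrow> p \<frown> \<omega> = q \<frown> \<omega>\<close>[OF that], of "length p"] by simp
    from this[of "\<lambda>_. 0"] this[of "\<lambda>_. 1"] show False
      using \<open>2 \<le> n\<close> by (simp add: cantor_def)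
  qed
  have "length u = length v"
    using *[of u v] *[of v u] eq by (metis linorder_neqE_nat)
  then show ?thesis
    using eq[OF zero_in_cantor[OF \<open>2 \<le> n\<close>]] by simp
qed

lemma has_branch_pairD:
  "has_branch_pair n f u v \<Longrightarrow> \<omega> \<in> cantor n \<Longrightarrow> f (u \<frown> \<omega>) = v \<frown> \<omega>"
  by (simp add: has_branch_pair_def)

lemma has_branch_pair_append:
  assumes "has_branch_pair n f u v" and "w \<in> words n"
  shows "has_branch_pair n f (u @ w) (v @ w)"
  unfolding has_branch_pair_def conc_conc[symmetric]
  using assms by (intro ballI has_branch_pairD) auto

lemma has_branch_pair_unique:
  "2 \<le> n \<Longrightarrow> has_branch_pair n f u v \<Longrightarrow> has_branch_pair n f u v' \<Longrightarrow> v = v'"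
  by (rule conc_cancel) (auto simp: has_branch_pair_def)

lemma has_branch_pair_words:
  assumes "2 \<le> n" "f ` cantor n \<subseteq> cantor n" "u \<in> words n" "has_branch_pair n f u v"
  shows "v \<in> words n"
proof -
  have "f (u \<frown> (\<lambda>_. 0)) \<in> cantor n"
    using assms(2,3) zero_in_cantor[OF assms(1)] by (simp add: image_subset_iff)
  then show ?thesis
    using has_branch_pairD[OF assms(4) zero_in_cantor[OF assms(1)]] by simp
qed

lemma has_branch_pair_children:
  assumes "\<And>a. a < n \<Longrightarrow> has_branch_pair n f (u @ [a]) (v @ [a])"
  shows "has_branch_pair n f u v"
  unfolding has_branch_pair_def
proof
  fix \<omega> assume \<omega>: "\<omega> \<in> cantor n"
  have "\<omega> = [\<omega> 0] \<frown> Omega_Words_Fun.suffix 1 \<omega>"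
    using initial_eq_conc[of \<omega> "[\<omega> 0]"] by simp
  moreover have "f ((u @ [\<omega> 0]) \<frown> Omega_Words_Fun.suffix 1 \<omega>)
      = (v @ [\<omega> 0]) \<frown> Omega_Words_Fun.suffix 1 \<omega>"
    using \<omega> assms by (intro has_branch_pairD) (auto simp: cantor_def)
  ultimately show "f (u \<frown> \<omega>) = v \<frown> \<omega>"
    by (metis conc_conc)
qed

text \<open>Only the source code has to be given. Bijectivity of \<open>f\<close> makes the targets
  prefix-free and complete, and monotonicity puts them in the right order.\<close>

lemma tree_diagram_of_code:
  assumes n: "2 \<le> n" and bij: "bij_betw f (cantor n) (cantor n)"
    and mono: "monotone_on (cantor n) less_fun less_fun f"
    and code: "complete_prefix_code n U"
    and branch: "\<And>u. u \<in> U \<Longrightarrow> has_branch_pair n f u (\<beta> u)"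
  shows "tree_diagram_of n f (map (\<lambda>u. (u, \<beta> u)) (sorted_list_of_set U))"
proof -
  have U: "finite U" "U \<subseteq> words n" "(\<Union>u\<in>U. cylinder n u) = cantor n"
    and antichain: "\<And>u v. u \<in> U \<Longrightarrow> v \<in> U \<Longrightarrow> Sublist.prefix u v \<Longrightarrow> u = v"
    using code unfolding complete_prefix_code_def by auto
  have f: "f ` cantor n = cantor n" "inj_on f (cantor n)"
    using bij by (auto simp: bij_betw_def)
  have z: "(\<lambda>_. 0) \<in> cantor n" using zero_in_cantor[OF n] .
  have words: "\<beta> u \<in> words n" if "u \<in> U" for u
    using has_branch_pair_words[OF n _ _ branch[OF that]] that U(2) f(1) by auto
  \<comment> \<open>If one target extends another, a point in both target cylinders has, by
    injectivity, one preimage lying in both source cylinders, so the source words are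
    comparable.\<close>
  have antichain': "u = v" if uv: "u \<in> U" "v \<in> U" "Sublist.prefix (\<beta> u) (\<beta> v)" for u v
  proof -
    obtain c where c: "\<beta> v = \<beta> u @ c" using uv(3) by (auto simp: Sublist.prefix_def)
    then have "c \<in> words n" using words[OF uv(2)] by simp
    then have "f (v \<frown> (\<lambda>_. 0)) = f (u \<frown> (c \<frown> (\<lambda>_. 0)))"
      using branch[OF uv(1)] branch[OF uv(2)] z c
      by (simp add: has_branch_pair_def del: conc_conc) simp
    then have "v \<frown> (\<lambda>_. 0) = u \<frown> (c \<frown> (\<lambda>_. 0))"
      by (rule inj_onD[OF f(2)]) (use U(2) uv \<open>c \<in> words n\<close> z in auto)
    then show ?thesis
      using conc_eq_comparable antichain[OF uv(1,2)] antichain[OF uv(2,1)] by metis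
  qed
  have cyl: "cylinder n (\<beta> u) = f ` cylinder n u" if "u \<in> U" for u
    using has_branch_pairD[OF branch[OF that]] by (auto simp: cylinder_def image_image)
  have cover: "(\<Union>v\<in>\<beta> ` U. cylinder n v) = cantor n"
    using cyl U(3) f(1) by (simp flip: image_UN)
  have less: "\<beta> u < \<beta> v" if uv: "u \<in> U" "v \<in> U" "u < v" for u v
  proof (rule ccontr)
    assume "\<not> \<beta> u < \<beta> v"
    have "\<not> Sublist.prefix u v" using antichain uv by blast
    then have "less_fun (u \<frown> (\<lambda>_. 0)) (v \<frown> (\<lambda>_. 0))"
      using less_fun_conc uv(3) by blast
    then have *: "less_fun (\<beta> u \<frown> (\<lambda>_. 0)) (\<beta> v \<frown> (\<lambda>_. 0))"
      using monotone_onD[OF mono, of "u \<frown> (\<lambda>_. 0)" "v \<frown> (\<lambda>_. 0)"] U(2) uv(1,2) z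
        has_branch_pairD[OF branch[OF uv(1)] z] has_branch_pairD[OF branch[OF uv(2)] z] by auto
    then have "\<beta> u \<noteq> \<beta> v" using less_fun_irrefl by metis
    then have "\<beta> v < \<beta> u" using \<open>\<not> \<beta> u < \<beta> v\<close> by simp
    moreover have "\<not> Sublist.prefix (\<beta> v) (\<beta> u)" using antichain' uv by blast
    ultimately show False using less_fun_conc less_fun_asym * by blast
  qed
  have "sorted_wrt (\<lambda>u v. \<beta> u < \<beta> v) (sorted_list_of_set U)"
    using U(1) less by (intro sorted_wrt_mono_rel[OF _ strict_sorted_list_of_set]) simp_all
  then have "sorted_wrt (<) (map \<beta> (sorted_list_of_set U))"
    by (simp add: sorted_wrt_map)
  moreover have "complete_prefix_code n (\<beta> ` U)"
    unfolding complete_prefix_code_def using U(1) words antichain' cover by auto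
  ultimately show ?thesis
    using U(1) code branch
    by (auto simp: tree_diagram_of_def tree_diagram_def image_image comp_def)
qed

text \<open>The shortest words of a bar are prefix-free by minimality and cover because every point
  meets the bar. They are finitely many because no minimal word is longer than the bound from the
  fan theorem.\<close>

lemma complete_prefix_code_minimal:
  assumes bar: "\<And>\<omega>. \<omega> \<in> cantor n \<Longrightarrow> \<exists>k. Q (initial k \<omega>)"
    and ext: "\<And>w a. Q w \<Longrightarrow> w \<in> words n \<Longrightarrow> a < n \<Longrightarrow> Q (w @ [a])"
  shows "complete_prefix_code n {w \<in> words n. Q w \<and> (\<forall>w'. strict_prefix w' w \<longrightarrow> \<not> Q w')}"
    (is "complete_prefix_code n ?U")
proof -
  obtain N where N: "\<And>w. w \<in> words n \<Longrightarrow> N \<le> length w \<Longrightarrow> Q w"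
    using cantor_fan[OF bar ext] by blast
  have "length w \<le> N" if "w \<in> ?U" for w
  proof (rule ccontr)
    assume "\<not> length w \<le> N"
    \<comment> \<open>The prefix of length \<open>N\<close> already satisfies \<open>Q\<close>,
      contradicting the minimality of the longer word \<open>w\<close>.\<close>
    moreover have "take N w \<in> words n"
      using that append_take_drop_id[of N w] words_append by (metis (lifting) mem_Collect_eq)
    ultimately have "Q (take N w)" using N by simp
    moreover have "strict_prefix (take N w) w"
      using \<open>\<not> length w \<le> N\<close> by (metis nle_le strict_prefixI take_all_iff take_is_prefix)
    ultimately show False using that by auto
  qed
  then have "?U \<subseteq> {w. set w \<subseteq> {..<n} \<and> length w \<le> N}"
    by (auto simp: words_def lists_eq_set)
  then have "finite ?U" using finite_lists_length_le finite_subset by blast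
  moreover have "\<omega> \<in> (\<Union>u\<in>?U. cylinder n u)" if \<omega>: "\<omega> \<in> cantor n" for \<omega>
  proof -
    define k where "k = (LEAST k. Q (initial k \<omega>))"
    obtain j where "Q (initial j \<omega>)" using bar[OF \<omega>] by blast
    then have "Q (initial k \<omega>)" unfolding k_def by (rule LeastI)
    moreover have "\<not> Q w'" if w': "strict_prefix w' (initial k \<omega>)" for w'
    proof -
      have "length w' < k" using prefix_length_less[OF w'] by simp
      moreover obtain zs where zs: "initial k \<omega> = w' @ zs"
        using w' by (auto simp: strict_prefix_def Sublist.prefix_def)
      have "w' = take (length w') (initial k \<omega>)"
        unfolding zs by simp
      ultimately have "w' = initial (length w') \<omega>" by simp
      then show ?thesis using \<open>length w' < k\<close> not_less_Least unfolding k_def by metis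
    qed
    ultimately have "initial k \<omega> \<in> ?U" using \<omega> by simp
    moreover have "\<omega> \<in> cylinder n (initial k \<omega>)" using \<omega> by (simp add: mem_cylinder_iff)
    ultimately show ?thesis by blast
  qed
  moreover have "(\<Union>u\<in>?U. cylinder n u) \<subseteq> cantor n" by (auto simp: cylinder_def)
  ultimately show ?thesis
    unfolding complete_prefix_code_def by (auto simp: strict_prefix_def)
qed

text \<open>The relation \<open>P\<close> is abstract because three instances occur:
  \<open>same_state\<close> of an automaton, the constant truth (plain membership in the Thompson
  group), and equality of runs in a quotient of the trees of the generators.\<close>

definition locally_accepted ::
  "nat \<Rightarrow> (nat list \<Rightarrow> nat list \<Rightarrow> bool) \<Rightarrow> ((nat \<Rightarrow> nat) \<Rightarrow> (nat \<Rightarrow> nat)) \<Rightarrow> bool" where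
  "locally_accepted n P f \<longleftrightarrow> (\<forall>\<omega>\<in>cantor n. \<exists>u\<in>words n. \<exists>v\<in>words n. \<exists>\<eta>\<in>cantor n.
     \<omega> = u \<frown> \<eta> \<and> has_branch_pair n f u v \<and> P u v)"

lemma locally_acceptedE:
  assumes "locally_accepted n P f" and "\<omega> \<in> cantor n"
  obtains u v \<eta> where "u \<in> words n" "v \<in> words n" "\<eta> \<in> cantor n" "\<omega> = u \<frown> \<eta>"
    "has_branch_pair n f u v" "P u v"
  using assms unfolding locally_accepted_def by blast

text \<open>This is what fullness gives to \<open>same_state\<close>: an accepted branch pair stays
  accepted when its cylinder is subdivided.\<close>

definition right_invariant :: "nat \<Rightarrow> (nat list \<Rightarrow> nat list \<Rightarrow> bool) \<Rightarrow> bool" where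
  "right_invariant n P \<longleftrightarrow> (\<forall>u\<in>words n. \<forall>v\<in>words n. \<forall>a<n. P u v \<longrightarrow> P (u @ [a]) (v @ [a]))"

lemma right_invariant_append:
  assumes "right_invariant n P" "P u v" "u \<in> words n" "v \<in> words n" "w \<in> words n"
  shows "P (u @ w) (v @ w)"
  using assms(5)
proof (induction w rule: rev_induct)
  case (snoc a w)
  then show ?case
    using assms(1,3,4) unfolding right_invariant_def
    by (metis append_assoc words_append words_Cons)
qed (use assms(2) in simp)

lemma locally_accepted_bar:
  assumes "locally_accepted n P f" and "\<omega> \<in> cantor n"
  shows "\<exists>k. \<exists>v\<in>words n. has_branch_pair n f (initial k \<omega>) v \<and> P (initial k \<omega>) v"
  using locally_acceptedE[OF assms] by (metis prefix_conc_length)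

lemma diagram_locally_accepted:
  assumes "tree_diagram_of n f d" and "\<And>u v. (u, v) \<in> set d \<Longrightarrow> P u v"
  shows "locally_accepted n P f"
  unfolding locally_accepted_def
proof
  fix \<omega> assume \<omega>: "\<omega> \<in> cantor n"
  have code: "complete_prefix_code n (fst ` set d)" "complete_prefix_code n (snd ` set d)"
    and branch: "\<And>u v. (u, v) \<in> set d \<Longrightarrow> has_branch_pair n f u v"
    using assms(1) by (auto simp: tree_diagram_of_def tree_diagram_def)
  have "\<omega> \<in> (\<Union>u\<in>fst ` set d. cylinder n u)"
    using \<omega> code(1) unfolding complete_prefix_code_def by blast
  then obtain p where p: "p \<in> set d" "\<omega> \<in> cylinder n (fst p)" by blast
  have words: "fst ` set d \<subseteq> words n" "snd ` set d \<subseteq> words n"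
    using code by (simp_all add: complete_prefix_code_def)
  define u v where "u = fst p" and "v = snd p"
  have "(u, v) \<in> set d" "\<omega> \<in> cylinder n u" using p by (simp_all add: u_def v_def)
  moreover have "u \<in> words n" "v \<in> words n"
    using words p(1) unfolding u_def v_def by blast+
  moreover obtain \<eta> where "\<eta> \<in> cantor n" "\<omega> = u \<frown> \<eta>"
    using p(2) by (auto simp: cylinder_def u_def)
  ultimately show "\<exists>u\<in>words n. \<exists>v\<in>words n. \<exists>\<eta>\<in>cantor n. \<omega> = u \<frown> \<eta> \<and> has_branch_pair n f u v \<and> P u v"
    using branch[of u v] assms(2)[of u v] by blast
qed

text \<open>The words at which some accepted branch pair starts form a bar, closed under extension
  by right invariance. Its minimal words are the leaves of the source tree.\<close>

lemma locally_accepted_diagram: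
  assumes n: "2 \<le> n" and bij: "bij_betw f (cantor n) (cantor n)"
    and mono: "monotone_on (cantor n) less_fun less_fun f"
    and acc: "locally_accepted n P f" and inv: "right_invariant n P"
  obtains d where "tree_diagram_of n f d" "\<And>u v. (u, v) \<in> set d \<Longrightarrow> P u v"
proof -
  define Q where "Q w \<longleftrightarrow> (\<exists>v\<in>words n. has_branch_pair n f w v \<and> P w v)" for w
  let ?U = "{w \<in> words n. Q w \<and> (\<forall>w'. strict_prefix w' w \<longrightarrow> \<not> Q w')}"
  have code: "complete_prefix_code n ?U"
  proof (rule complete_prefix_code_minimal)
    show "\<exists>k. Q (initial k \<omega>)" if "\<omega> \<in> cantor n" for \<omega>
      unfolding Q_def using locally_accepted_bar[OF acc that] .
    fix w a assume "Q w" "w \<in> words n" "a < n"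
    then obtain v where "v \<in> words n" "has_branch_pair n f w v" "P w v" by (auto simp: Q_def)
    then show "Q (w @ [a])"
      unfolding Q_def using \<open>w \<in> words n\<close> \<open>a < n\<close> inv
      by (intro bexI[of _ "v @ [a]"]) (auto simp: right_invariant_def intro: has_branch_pair_append)
  qed
  define \<beta> where "\<beta> u = (SOME v. has_branch_pair n f u v \<and> P u v)" for u
  have \<beta>: "has_branch_pair n f u (\<beta> u) \<and> P u (\<beta> u)" if "u \<in> ?U" for u
    unfolding \<beta>_def by (rule someI_ex) (use that in \<open>auto simp: Q_def\<close>)
  have "finite ?U" using code by (simp add: complete_prefix_code_def)
  show thesis
  proof (rule that)
    show "tree_diagram_of n f (map (\<lambda>u. (u, \<beta> u)) (sorted_list_of_set ?U))"
      using \<beta> by (intro tree_diagram_of_code[OF n bij mono code]) blast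
    show "P u v" if "(u, v) \<in> set (map (\<lambda>u. (u, \<beta> u)) (sorted_list_of_set ?U))" for u v
      using that \<beta> \<open>finite ?U\<close> by auto
  qed
qed

section \<open>The Higman--Thompson group\<close>

lemma homeomorphism_bij_betw: "homeomorphism X Y f g \<Longrightarrow> bij_betw f X Y"
  by (rule bij_betwI[where g = g]) (auto simp: homeomorphism_def)

lemma thompson_bij: "f \<in> thompson n \<Longrightarrow> bij_betw f (cantor n) (cantor n)"
  by (auto simp: thompson_def intro: homeomorphism_bij_betw)

lemma thompson_in_cantor: "f \<in> thompson n \<Longrightarrow> \<omega> \<in> cantor n \<Longrightarrow> f \<omega> \<in> cantor n"
  using bij_betw_apply thompson_bij by metis

lemma thompson_mono: "f \<in> thompson n \<Longrightarrow> monotone_on (cantor n) less_fun less_fun f"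
  by (simp add: thompson_def)

lemma thompson_extensional: "f \<in> thompson n \<Longrightarrow> f \<in> extensional (cantor n)"
  by (simp add: thompson_def)

lemma thompson_subset_Bij: "thompson n \<subseteq> Bij (cantor n)"
  using thompson_bij thompson_extensional by (auto simp: Bij_def)

lemma thompson_locally_accepted:
  assumes "f \<in> thompson n"
  shows "locally_accepted n (\<lambda>_ _. True) f"
  using assms diagram_locally_accepted[of n f _ "\<lambda>_ _. True"] by (auto simp: thompson_def)

text \<open>The source leaves are the minimal words with any branch pair at all. A reducible caret
  below \<open>u\<close> would give \<open>u\<close> itself a branch pair, against the minimality of
  its child. Existence ensures that every generator contributes trees to the core.\<close>

lemma reduced_diagram_exists:
  assumes n: "2 \<le> n" and f: "f \<in> thompson n"
  obtains d where "tree_diagram_of n f d" "reduced_diagram n d"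
proof -
  define Q where "Q w \<longleftrightarrow> (\<exists>v. has_branch_pair n f w v)" for w
  let ?U = "{w \<in> words n. Q w \<and> (\<forall>w'. strict_prefix w' w \<longrightarrow> \<not> Q w')}"
  have code: "complete_prefix_code n ?U"
  proof (rule complete_prefix_code_minimal)
    show "\<exists>k. Q (initial k \<omega>)" if "\<omega> \<in> cantor n" for \<omega>
      unfolding Q_def using locally_accepted_bar[OF thompson_locally_accepted[OF f] that] by auto
    show "Q (w @ [a])" if "Q w" "w \<in> words n" "a < n" for w a
      using that has_branch_pair_append[of n f w _ "[a]"] by (auto simp: Q_def)
  qed
  then have "finite ?U" by (simp add: complete_prefix_code_def)
  define \<beta> where "\<beta> u = (SOME v. has_branch_pair n f u v)" for u
  have \<beta>: "has_branch_pair n f u (\<beta> u)" if "u \<in> ?U" for u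
    unfolding \<beta>_def by (rule someI_ex) (use that in \<open>auto simp: Q_def\<close>)
  let ?d = "map (\<lambda>u. (u, \<beta> u)) (sorted_list_of_set ?U)"
  have "tree_diagram_of n f ?d"
    using tree_diagram_of_code[OF n thompson_bij[OF f] thompson_mono[OF f] code] \<beta> by blast
  moreover have "reduced_diagram n ?d"
    unfolding reduced_diagram_def
  proof safe
    fix i u v
    assume i: "i + n \<le> length ?d" and *: "\<forall>a<n. ?d ! (i + a) = (u @ [a], v @ [a])"
    have mem: "(u @ [a], v @ [a]) \<in> set ?d" if "a < n" for a
    proof -
      have "i + a < length ?d" using that i by linarith
      then have "?d ! (i + a) \<in> set ?d" by (rule nth_mem)
      moreover have "?d ! (i + a) = (u @ [a], v @ [a])" using * that by blast
      ultimately show ?thesis by (simp only:)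
    qed
    have U: "u @ [a] \<in> ?U \<and> v @ [a] = \<beta> (u @ [a])" if "a < n" for a
    proof -
      have "(u @ [a], v @ [a]) \<in> (\<lambda>u. (u, \<beta> u)) ` ?U"
        using mem[OF that] \<open>finite ?U\<close> by (simp only: set_map set_sorted_list_of_set)
      then show ?thesis by (rule imageE) (simp only: prod.inject)
    qed
    have "has_branch_pair n f u v"
    proof (rule has_branch_pair_children)
      fix a assume "a < n"
      then show "has_branch_pair n f (u @ [a]) (v @ [a])"
        using \<beta>[of "u @ [a]"] U[of a] by (simp only: simp_thms)
    qed
    then have "Q u" unfolding Q_def ..
    moreover have "u @ [0] \<in> ?U" using U[of 0] n by simp
    moreover have "strict_prefix u (u @ [0])" by (simp add: strict_prefix_def)
    ultimately show False by blast
  qed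
  ultimately show thesis by (rule that)
qed

lemma thompson_inverse:
  assumes f: "f \<in> thompson n"
  obtains g where "g \<in> thompson n" "\<And>\<omega>. \<omega> \<in> cantor n \<Longrightarrow> g (f \<omega>) = \<omega>"
    "\<And>\<omega>. \<omega> \<in> cantor n \<Longrightarrow> f (g \<omega>) = \<omega>"
proof -
  obtain g0 d where hom: "homeomorphism (cantor n) (cantor n) f g0" and d: "tree_diagram_of n f d"
    using f by (auto simp: thompson_def)
  define g where "g = restrict g0 (cantor n)"
  have g: "homeomorphism (cantor n) (cantor n) g f"
    using homeomorphism_cong[OF homeomorphism_symD[OF hom] refl refl, of g f]
    by (simp add: g_def)
  have gf: "g (f \<omega>) = \<omega>" and fg: "f (g \<omega>) = \<omega>" if "\<omega> \<in> cantor n" for \<omega>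
    using g that by (auto simp: homeomorphism_def)
  have words: "fst ` set d \<subseteq> words n"
    using d by (auto simp: tree_diagram_of_def tree_diagram_def complete_prefix_code_def)
  have "has_branch_pair n g v u" if "(u, v) \<in> set d" for u v
    unfolding has_branch_pair_def
  proof
    fix \<omega> assume \<omega>: "\<omega> \<in> cantor n"
    have "u \<in> words n" using that words by force
    moreover have "f (u \<frown> \<omega>) = v \<frown> \<omega>"
      using that d \<omega> by (auto simp: tree_diagram_of_def has_branch_pair_def)
    ultimately show "g (v \<frown> \<omega>) = u \<frown> \<omega>" using gf[of "u \<frown> \<omega>"] \<omega> by simp
  qed
  moreover have "tree_diagram n (map prod.swap d)"
    using d by (auto simp: tree_diagram_of_def tree_diagram_def image_image comp_def)
  ultimately have "tree_diagram_of n g (map prod.swap d)"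
    by (auto simp: tree_diagram_of_def)
  moreover have "monotone_on (cantor n) less_fun less_fun g"
    using monotone_on_inverse[OF thompson_mono[OF f] _ fg] g by (auto simp: homeomorphism_def)
  ultimately have "g \<in> thompson n"
    using g by (auto simp: thompson_def g_def)
  then show thesis using that gf fg by blast
qed

lemma thompson_group_mult:
  assumes "f \<in> Bij (cantor n)" "g \<in> Bij (cantor n)"
  shows "f \<otimes>\<^bsub>thompson_group n\<^esub> g = compose (cantor n) f g"
  using assms by (simp add: thompson_group_def BijGroup_def)

lemma thompson_group_one: "\<one>\<^bsub>thompson_group n\<^esub> = (\<lambda>\<omega>\<in>cantor n. \<omega>)"
  by (simp add: thompson_group_def BijGroup_def)

text \<open>\<open>m_inv\<close> is a definite description. Uniqueness follows by cancelling
  \<open>f\<close> pointwise with \<open>g\<close>, using that elements are extensional.\<close>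

lemma thompson_group_inv:
  assumes f: "f \<in> thompson n" and g: "g \<in> thompson n"
    and gf: "\<And>\<omega>. \<omega> \<in> cantor n \<Longrightarrow> g (f \<omega>) = \<omega>"
    and fg: "\<And>\<omega>. \<omega> \<in> cantor n \<Longrightarrow> f (g \<omega>) = \<omega>"
  shows "inv\<^bsub>thompson_group n\<^esub> f = g"
  unfolding m_inv_def
proof (rule the_equality)
  have Bij: "h \<in> Bij (cantor n)" if "h \<in> thompson n" for h
    using that thompson_subset_Bij by blast
  have "carrier (thompson_group n) = thompson n" by (simp add: thompson_group_def)
  note [simp] = this thompson_group_mult[OF Bij Bij] thompson_group_one
  show "g \<in> carrier (thompson_group n) \<and> f \<otimes>\<^bsub>thompson_group n\<^esub> g = \<one>\<^bsub>thompson_group n\<^esub> \<and>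
      g \<otimes>\<^bsub>thompson_group n\<^esub> f = \<one>\<^bsub>thompson_group n\<^esub>"
    using f g gf fg by (auto simp: compose_def)
  fix h assume h: "h \<in> carrier (thompson_group n) \<and> f \<otimes>\<^bsub>thompson_group n\<^esub> h = \<one>\<^bsub>thompson_group n\<^esub> \<and>
      h \<otimes>\<^bsub>thompson_group n\<^esub> f = \<one>\<^bsub>thompson_group n\<^esub>"
  then have "compose (cantor n) f h = (\<lambda>\<omega>\<in>cantor n. \<omega>)" "h \<in> thompson n" using f by auto
  then have "f (h \<omega>) = \<omega>" if "\<omega> \<in> cantor n" for \<omega>
    using that by (metis compose_eq restrict_apply')
  then show "h = g"
    using \<open>h \<in> thompson n\<close> g gf
    by (intro extensionalityI[of _ "cantor n"] thompson_extensional) (metis thompson_in_cantor)+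
qed

text \<open>The target word of the pair for \<open>g\<close> and the source word of the pair for
  \<open>f\<close> are prefixes of one point, but in general different. Both pairs are extended
  until these two words agree; then transitivity of \<open>P\<close> applies.\<close>

lemma locally_accepted_compose:
  assumes n: "2 \<le> n" and f: "locally_accepted n P f" and g: "locally_accepted n P g"
    and inv: "right_invariant n P" and trans: "\<And>u v w. P u v \<Longrightarrow> P v w \<Longrightarrow> P u w"
  shows "locally_accepted n P (compose (cantor n) f g)"
  unfolding locally_accepted_def
proof
  fix \<omega> assume \<omega>: "\<omega> \<in> cantor n"
  obtain u v \<eta> where u: "u \<in> words n" "v \<in> words n" "\<eta> \<in> cantor n" "\<omega> = u \<frown> \<eta>"
    "has_branch_pair n g u v" "P u v"
    using locally_acceptedE[OF g \<omega>] .
  have "v \<frown> \<eta> \<in> cantor n" using u by simp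
  then obtain u' v' \<eta>' where u': "u' \<in> words n" "v' \<in> words n" "\<eta>' \<in> cantor n" "v \<frown> \<eta> = u' \<frown> \<eta>'"
    "has_branch_pair n f u' v'" "P u' v'"
    using locally_acceptedE[OF f] by blast
  \<comment> \<open>Each extension has the length of the opposite word, so \<open>v @ w\<close> and
    \<open>u' @ w'\<close> are both the prefix of length \<open>length v + length u'\<close> of the
    same point.\<close>
  define w where "w = initial (length u') \<eta>"
  define \<eta>2 where "\<eta>2 = Omega_Words_Fun.suffix (length u') \<eta>"
  define w' where "w' = initial (length v) \<eta>'"
  have eta: "\<eta> = w \<frown> \<eta>2" by (simp add: w_def \<eta>2_def)
  have w: "w \<in> words n" "w' \<in> words n" "\<eta>2 \<in> cantor n"
    using u(3) u'(3) by (simp_all add: w_def w'_def \<eta>2_def)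
  have vw: "v @ w = u' @ w'"
    using arg_cong[OF u'(4), of "initial (length v + length u')"]
    by (simp add: w_def w'_def)
  have "has_branch_pair n (compose (cantor n) f g) (u @ w) (v' @ w')"
    unfolding has_branch_pair_def
  proof
    fix \<zeta> assume \<zeta>: "\<zeta> \<in> cantor n"
    have "g ((u @ w) \<frown> \<zeta>) = (u' @ w') \<frown> \<zeta>"
      using has_branch_pairD[OF has_branch_pair_append[OF u(5) w(1)] \<zeta>] vw by simp
    moreover have "f ((u' @ w') \<frown> \<zeta>) = (v' @ w') \<frown> \<zeta>"
      using has_branch_pairD[OF has_branch_pair_append[OF u'(5) w(2)] \<zeta>] .
    ultimately show "compose (cantor n) f g ((u @ w) \<frown> \<zeta>) = (v' @ w') \<frown> \<zeta>"
      using u(1) w(1) \<zeta> by (simp add: compose_def)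
  qed
  moreover have "P (u @ w) (v' @ w')"
    using right_invariant_append[OF inv u(6,1,2) w(1)] right_invariant_append[OF inv u'(6,1,2) w(2)]
      trans vw by metis
  moreover have "\<omega> = (u @ w) \<frown> \<eta>2" using u(4) eta by simp
  ultimately show "\<exists>u\<in>words n. \<exists>v\<in>words n. \<exists>\<eta>\<in>cantor n. \<omega> = u \<frown> \<eta> \<and>
      has_branch_pair n (compose (cantor n) f g) u v \<and> P u v"
    using u(1) u'(2) w by (metis words_append)
qed

lemma locally_accepted_inverse:
  assumes f: "f \<in> thompson n" and acc: "locally_accepted n P f" and sym: "\<And>u v. P u v \<Longrightarrow> P v u"
    and g: "g \<in> thompson n"
    and gf: "\<And>\<omega>. \<omega> \<in> cantor n \<Longrightarrow> g (f \<omega>) = \<omega>" and fg: "\<And>\<omega>. \<omega> \<in> cantor n \<Longrightarrow> f (g \<omega>) = \<omega>"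
  shows "locally_accepted n P g"
  unfolding locally_accepted_def
proof
  fix \<omega> assume \<omega>: "\<omega> \<in> cantor n"
  obtain u v \<eta> where u: "u \<in> words n" "v \<in> words n" "\<eta> \<in> cantor n" "g \<omega> = u \<frown> \<eta>"
    "has_branch_pair n f u v" "P u v"
    using locally_acceptedE[OF acc thompson_in_cantor[OF g \<omega>]] .
  have "\<omega> = v \<frown> \<eta>" using fg[OF \<omega>] u(3,4) has_branch_pairD[OF u(5)] by simp
  moreover have "has_branch_pair n g v u"
    unfolding has_branch_pair_def
    using gf u(1) has_branch_pairD[OF u(5)] by (metis conc_in_cantor)
  ultimately show "\<exists>u\<in>words n. \<exists>v\<in>words n. \<exists>\<eta>\<in>cantor n. \<omega> = u \<frown> \<eta> \<and> has_branch_pair n g u v \<and> P u v"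
    using u sym by blast
qed

lemma locally_accepted_generate:
  assumes n: "2 \<le> n" and T: "T \<subseteq> thompson n" "\<And>t. t \<in> T \<Longrightarrow> locally_accepted n P t"
    and inv: "right_invariant n P" and refl: "P [] []" and sym: "\<And>u v. P u v \<Longrightarrow> P v u"
    and trans: "\<And>u v w. P u v \<Longrightarrow> P v w \<Longrightarrow> P u w"
    and k: "k \<in> generate (thompson_group n) T"
  shows "locally_accepted n P k"
proof -
  \<comment> \<open>Membership in \<open>Bij\<close> is carried through the induction because
    multiplication is \<open>compose\<close> only there.\<close>
  have "k \<in> Bij (cantor n) \<and> locally_accepted n P k"
    using k
  proof (induction k rule: generate.induct)
    case one
    have "has_branch_pair n (\<lambda>\<omega>\<in>cantor n. \<omega>) [] []" by (simp add: has_branch_pair_def)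
    then have "locally_accepted n P (\<lambda>\<omega>\<in>cantor n. \<omega>)"
      unfolding locally_accepted_def using refl words_Nil by (metis conc_empty)
    then show ?case using id_Bij thompson_group_one by metis
  next
    case (incl h)
    then show ?case using T thompson_subset_Bij by blast
  next
    case (inv h)
    have h: "h \<in> thompson n" using inv T by blast
    then obtain g where g: "g \<in> thompson n" "\<And>\<omega>. \<omega> \<in> cantor n \<Longrightarrow> g (h \<omega>) = \<omega>"
      "\<And>\<omega>. \<omega> \<in> cantor n \<Longrightarrow> h (g \<omega>) = \<omega>" using thompson_inverse by blast
    have "locally_accepted n P g"
      by (rule locally_accepted_inverse[OF h T(2)[OF inv] sym g])
    then show ?case
      using thompson_group_inv[OF h g] g(1) thompson_subset_Bij by auto
  next
    case (eng h1 h2)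
    then show ?case
      using thompson_group_mult[of h1 n h2] compose_Bij[of h1 "cantor n" h2]
        locally_accepted_compose[OF n, of P h1 h2] assms(4) trans by auto
  qed
  then show ?thesis ..
qed

text \<open>A branch pair of an accepted \<open>f\<close> need not be accepted itself. Along each
  point, however, it has a common extension with an accepted pair, and a source word has only one
  target word.\<close>

lemma locally_accepted_refine:
  assumes m: "2 \<le> m" and acc: "locally_accepted m P f" and inv: "right_invariant m P"
    and uv: "has_branch_pair m f u v" "u \<in> words m" "v \<in> words m" and \<omega>: "\<omega> \<in> cantor m"
  obtains k where "P (u @ initial k \<omega>) (v @ initial k \<omega>)"
proof -
  have "u \<frown> \<omega> \<in> cantor m" using uv \<omega> by simp
  then obtain u' v' \<eta> where u': "u' \<in> words m" "v' \<in> words m" "\<eta> \<in> cantor m"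
    "u \<frown> \<omega> = u' \<frown> \<eta>" "has_branch_pair m f u' v'" "P u' v'"
    using locally_acceptedE[OF acc] by blast
  \<comment> \<open>Again each word is lengthened by the length of the other, so that
    \<open>u' @ e\<close> and \<open>u @ initial k \<omega>\<close> coincide.\<close>
  define e where "e = initial (length u) \<eta>"
  define k where "k = length u'"
  have e: "u' @ e = u @ initial k \<omega>"
    using arg_cong[OF u'(4), of "initial (length u + length u')"] by (simp add: e_def k_def)
  have "e \<in> words m" using u'(3) by (simp add: e_def)
  have "has_branch_pair m f (u' @ e) (v' @ e)"
    using has_branch_pair_append u'(5) \<open>e \<in> words m\<close> by blast
  moreover have "has_branch_pair m f (u @ initial k \<omega>) (v @ initial k \<omega>)"
    using has_branch_pair_append uv(1) \<omega> by simp
  ultimately have "v' @ e = v @ initial k \<omega>"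
    using has_branch_pair_unique[OF m] e by simp
  then show thesis
    using that[of k] right_invariant_append[OF inv u'(6,1,2) \<open>e \<in> words m\<close>] e by simp
qed

lemma right_invariant_fan:
  assumes inv: "right_invariant m P" and uv: "u \<in> words m" "v \<in> words m"
    and bar: "\<And>\<omega>. \<omega> \<in> cantor m \<Longrightarrow> \<exists>k. P (u @ initial k \<omega>) (v @ initial k \<omega>)"
  obtains M where "\<And>e. e \<in> words m \<Longrightarrow> M \<le> length e \<Longrightarrow> P (u @ e) (v @ e)"
proof (rule cantor_fan[of m "\<lambda>e. P (u @ e) (v @ e)"])
  fix w a assume "P (u @ w) (v @ w)" "w \<in> words m" "a < m"
  then show "P (u @ w @ [a]) (v @ w @ [a])"
    using right_invariant_append[OF inv, of "u @ w" "v @ w" "[a]"] uv by simp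
qed (use bar that in blast)+

section \<open>Full automata\<close>

lemma run_append: "run A q (u @ v) = Option.bind (run A q u) (\<lambda>q'. run A q' v)"
  by (induction u arbitrary: q) (simp_all add: Option.bind_assoc)

locale full_automaton =
  fixes m :: nat and P :: "'q automaton"
  assumes two_le: "2 \<le> m" and tree: "tree_automaton m P" and full: "full m P"
begin

text \<open>In a full automaton runs from states along words over the alphabet never fail, so the
  default of \<open>the\<close> does not occur there.\<close>

definition dest :: "'q \<Rightarrow> nat list \<Rightarrow> 'q" where
  "dest q w = the (run P q w)"

abbreviation state_of :: "nat list \<Rightarrow> 'q" where
  "state_of w \<equiv> dest (root P) w"

lemma trans_Some: "q \<in> states P \<Longrightarrow> a < m \<Longrightarrow> \<exists>q'\<in>states P. trans P q a = Some q'"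
proof -
  assume q: "q \<in> states P" and a: "a < m"
  then have "trans P q a \<noteq> None"
    using full by (simp add: full_def father_state_def)
  then obtain q' where "trans P q a = Some q'" by blast
  then show ?thesis
    using tree q a by (auto simp: tree_automaton_def)
qed

lemma run_Some: "q \<in> states P \<Longrightarrow> w \<in> words m \<Longrightarrow> run P q w = Some (dest q w) \<and> dest q w \<in> states P"
proof (induction w arbitrary: q)
  case (Cons a w)
  then obtain q' where q': "q' \<in> states P" "trans P q a = Some q'"
    using trans_Some[of q a] by auto
  then have "run P q (a # w) = run P q' w" by simp
  then show ?case using Cons.IH[OF q'(1)] Cons.prems(2) by (simp add: dest_def)
qed (simp add: dest_def)

lemma root_in_states: "root P \<in> states P"
  using tree by (simp add: tree_automaton_def)

lemma dest_Nil [simp]: "dest q [] = q"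
  by (simp add: dest_def)

lemma dest_in_states: "q \<in> states P \<Longrightarrow> w \<in> words m \<Longrightarrow> dest q w \<in> states P"
  using run_Some by blast

lemma dest_append: "q \<in> states P \<Longrightarrow> u \<in> words m \<Longrightarrow> dest q (u @ v) = dest (dest q u) v"
proof -
  assume "q \<in> states P" "u \<in> words m"
  then have "run P q (u @ v) = run P (dest q u) v"
    using run_Some[of q u] by (simp add: run_append)
  then show ?thesis by (simp add: dest_def)
qed

lemma trans_eq: "q \<in> states P \<Longrightarrow> a < m \<Longrightarrow> trans P q a = Some (dest q [a])"
  using trans_Some by (fastforce simp: dest_def)

lemma reachable: "q \<in> states P \<Longrightarrow> \<exists>w\<in>words m. state_of w = q"
  using tree unfolding tree_automaton_def dest_def by (metis option.sel)

lemma same_state_iff: "u \<in> words m \<Longrightarrow> v \<in> words m \<Longrightarrow> same_state P u v \<longleftrightarrow> state_of u = state_of v"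
  using run_Some[OF root_in_states] by (auto simp: same_state_def)

lemma right_invariant_same_state: "right_invariant m (same_state P)"
  unfolding right_invariant_def by (simp add: same_state_iff dest_append root_in_states)

lemma diagram_group_locally_accepted:
  assumes "f \<in> diagram_group m P"
  shows "locally_accepted m (same_state P) f"
proof -
  obtain d where "tree_diagram_of m f d" "accepted P d"
    using assms by (auto simp: diagram_group_def)
  then show ?thesis by (intro diagram_locally_accepted) (auto simp: accepted_def)
qed

definition eventually_equal :: "('q \<times> 'q) set" where
  "eventually_equal = {(p, q). p \<in> states P \<and> q \<in> states P \<and>
     (\<exists>N. \<forall>w\<in>words m. N \<le> length w \<longrightarrow> dest p w = dest q w)}"

lemma eventually_equalI:
  "p \<in> states P \<Longrightarrow> q \<in> states P \<Longrightarrow> (\<And>w. w \<in> words m \<Longrightarrow> N \<le> length w \<Longrightarrow> dest p w = dest q w)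
    \<Longrightarrow> (p, q) \<in> eventually_equal"
  unfolding eventually_equal_def by blast

lemma eventually_equalE:
  assumes "(p, q) \<in> eventually_equal"
  obtains N where "p \<in> states P" "q \<in> states P"
    "\<forall>w\<in>words m. N \<le> length w \<longrightarrow> dest p w = dest q w"
  using assms unfolding eventually_equal_def by blast

lemma equiv_eventually_equal: "equiv (states P) eventually_equal"
proof (rule equivI)
  show "eventually_equal \<subseteq> states P \<times> states P" by (auto simp: eventually_equal_def)
  show "refl_on (states P) eventually_equal"
    by (rule refl_onI) (auto intro: eventually_equalI)
  show "sym eventually_equal"
  proof (rule symI)
    fix p q assume "(p, q) \<in> eventually_equal"
    then obtain N where "p \<in> states P" "q \<in> states P"
      "\<forall>w\<in>words m. N \<le> length w \<longrightarrow> dest p w = dest q w"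
      by (rule eventually_equalE)
    then show "(q, p) \<in> eventually_equal" by (intro eventually_equalI[where N = N]) simp_all
  qed
  show "Relation.trans eventually_equal"
  proof (rule transI)
    fix p q r assume pq: "(p, q) \<in> eventually_equal" and qr: "(q, r) \<in> eventually_equal"
    obtain N where "p \<in> states P" "\<forall>w\<in>words m. N \<le> length w \<longrightarrow> dest p w = dest q w"
      using pq by (rule eventually_equalE)
    moreover obtain M where "r \<in> states P" "\<forall>w\<in>words m. M \<le> length w \<longrightarrow> dest q w = dest r w"
      using qr by (rule eventually_equalE)
    ultimately show "(p, r) \<in> eventually_equal"
      by (intro eventually_equalI[where N = "max N M"]) simp_all
  qed
qed

lemma eventually_equal_dest:
  assumes "(p, q) \<in> eventually_equal" and "a < m"
  shows "(dest p [a], dest q [a]) \<in> eventually_equal"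
proof -
  obtain N where pq: "p \<in> states P" "q \<in> states P"
    and N: "\<forall>w\<in>words m. N \<le> length w \<longrightarrow> dest p w = dest q w"
    using assms(1) by (rule eventually_equalE)
  have *: "dest r (a # w) = dest (dest r [a]) w" if "r \<in> states P" for r w
    using dest_append[OF that, of "[a]" w] assms(2) by simp
  show ?thesis
  proof (rule eventually_equalI[where N = N])
    fix w assume "w \<in> words m" "N \<le> length w"
    then have "dest p (a # w) = dest q (a # w)"
      using bspec[OF N, of "a # w"] assms(2) by simp
    then show "dest (dest p [a]) w = dest (dest q [a]) w"
      using *[OF pq(1), of w] *[OF pq(2), of w] by metis
  qed (use pq assms(2) in \<open>simp_all add: dest_in_states\<close>)
qed

lemma eventually_equal_folded:
  assumes pq: "p \<in> states P" "q \<in> states P"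
    and children: "\<And>a. a < m \<Longrightarrow> (dest p [a], dest q [a]) \<in> eventually_equal"
  shows "(p, q) \<in> eventually_equal"
proof -
  have "\<exists>N. \<forall>w\<in>words m. N \<le> length w \<longrightarrow> dest (dest p [a]) w = dest (dest q [a]) w" if "a < m" for a
    using children[OF that] by (elim eventually_equalE) blast
  then obtain N where N: "\<And>a w. a < m \<Longrightarrow> w \<in> words m \<Longrightarrow> N a \<le> length w \<Longrightarrow>
      dest (dest p [a]) w = dest (dest q [a]) w"
    by metis
  show ?thesis
  \<comment> \<open>The sum dominates the bounds of all children; \<open>Suc\<close> pays for the
    first letter.\<close>
  proof (rule eventually_equalI[OF pq, where N = "Suc (\<Sum>a<m. N a)"])
    fix w assume w: "w \<in> words m" "Suc (\<Sum>a<m. N a) \<le> length w"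
    then obtain a w' where w': "w = a # w'" "a < m" "w' \<in> words m" by (cases w) auto
    have "N a \<le> (\<Sum>a<m. N a)" using w'(2) by (intro member_le_sum) auto
    then show "dest p w = dest q w"
      using N[OF w'(2,3)] w w' dest_append[OF pq(1), of "[a]" w'] dest_append[OF pq(2), of "[a]" w']
      by simp
  qed
qed

text \<open>Induction on the length from which the destinations agree. At length 0 the states
  coincide; otherwise their children agree one letter sooner, and the closure condition lifts this
  to the parents.\<close>

lemma eventually_equal_least:
  assumes refl: "\<And>p. p \<in> states P \<Longrightarrow> (p, p) \<in> R"
    and folded: "\<And>p q. p \<in> states P \<Longrightarrow> q \<in> states P \<Longrightarrow>
      (\<And>a. a < m \<Longrightarrow> (dest p [a], dest q [a]) \<in> R) \<Longrightarrow> (p, q) \<in> R"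
  shows "eventually_equal \<subseteq> R"
proof -
  have "(p, q) \<in> R" if "p \<in> states P" "q \<in> states P"
    "\<forall>w\<in>words m. N \<le> length w \<longrightarrow> dest p w = dest q w" for N p q
    using that
  proof (induction N arbitrary: p q)
    case 0
    then have "p = q" using bspec[OF 0(3) words_Nil] by simp
    then show ?case using refl 0(1) by simp
  next
    case (Suc N)
    show ?case
    proof (rule folded[OF Suc.prems(1,2)])
      fix a assume a: "a < m"
      have "dest (dest p [a]) w = dest (dest q [a]) w" if "w \<in> words m" "N \<le> length w" for w
        using Suc.prems(3)[rule_format, of "a # w"] that a
          dest_append[OF Suc.prems(1), of "[a]" w] dest_append[OF Suc.prems(2), of "[a]" w] by simp
      then show "(dest p [a], dest q [a]) \<in> R"
        using Suc.prems(1,2) a by (intro Suc.IH dest_in_states) auto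
    qed
  qed
  then show ?thesis by (auto elim!: eventually_equalE)
qed

end

section \<open>Folding relations\<close>

definition admissible ::
  "nat \<Rightarrow> 'v set \<Rightarrow> ('v \<times> nat \<times> 'v) set \<Rightarrow> ('v \<times> 'v) set \<Rightarrow> ('v \<times> 'v) set \<Rightarrow> bool" where
  "admissible n V E I R \<longleftrightarrow> equiv V R \<and> I \<subseteq> R \<and>
     deterministic_edges (quotient_edges E R) \<and> folded_edges n (quotient_edges E R)"

lemma folding_relation_eqI:
  assumes "admissible n V E I R" and "\<And>R'. admissible n V E I R' \<Longrightarrow> R \<subseteq> R'"
  shows "folding_relation n V E I = R"
  using assms unfolding folding_relation_def admissible_def by (intro equalityI) blast+

lemma quotient_edges_iff:
  "(X, a, Y) \<in> quotient_edges E R \<longleftrightarrow> (\<exists>x y. (x, a, y) \<in> E \<and> X = R `` {x} \<and> Y = R `` {y})"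
  unfolding quotient_edges_def by blast

lemma quotient_edgesI: "(x, a, y) \<in> E \<Longrightarrow> (R `` {x}, a, R `` {y}) \<in> quotient_edges E R"
  unfolding quotient_edges_iff by blast

lemma quotient_automaton_trans:
  assumes "deterministic_edges (quotient_edges E R)" and "(X, a, Y) \<in> quotient_edges E R"
  shows "trans (quotient_automaton V E r R) X a = Some Y"
proof -
  have "(THE Y. (X, a, Y) \<in> quotient_edges E R) = Y"
    using assms unfolding deterministic_edges_def by (intro the_equality) metis+
  moreover have "\<exists>Y. (X, a, Y) \<in> quotient_edges E R" using assms(2) ..
  ultimately show ?thesis by (simp add: quotient_automaton_def)
qed

context full_automaton
begin

text \<open>Used twice: with the identity on the graph of \<open>P\<close> itself, and with
  \<open>vertex_state\<close> on the trees of the generators. The graph may lack edges; foldedness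
  is needed only between classes that have an edge for every letter.\<close>

lemma admissible_state_map:
  assumes edges: "\<And>x a y. (x, a, y) \<in> E \<Longrightarrow> x \<in> V \<and> y \<in> V \<and> a < m \<and> W y = dest (W x) [a]"
    and W: "\<And>x. x \<in> V \<Longrightarrow> W x \<in> states P"
    and I: "\<And>x y. (x, y) \<in> I \<Longrightarrow> x \<in> V \<and> y \<in> V \<and> (W x, W y) \<in> eventually_equal"
  shows "admissible m V E I {(x, y). x \<in> V \<and> y \<in> V \<and> (W x, W y) \<in> eventually_equal}"
    (is "admissible m V E I ?R")
proof -
  note ev_equiv = equiv_eventually_equal
  have refl: "(W x, W x) \<in> eventually_equal" if "x \<in> V" for x
    using ev_equiv W[OF that] by (simp add: equiv_def refl_on_def)
  have sym: "(q, p) \<in> eventually_equal" if "(p, q) \<in> eventually_equal" for p q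
    using ev_equiv that unfolding equiv_def by (blast dest: symD)
  have trans: "(p, r) \<in> eventually_equal"
    if "(p, q) \<in> eventually_equal" "(q, r) \<in> eventually_equal" for p q r
    using ev_equiv that unfolding equiv_def by (blast dest: transD)
  define R where "R = ?R"
  have equiv: "equiv V R"
  proof (rule equivI)
    show "Relation.trans R" by (rule transI) (auto simp: R_def intro: trans)
    show "sym R" by (rule symI) (auto simp: R_def intro: sym)
  qed (auto simp: R_def refl_on_def intro: refl)
  have class_eq: "R `` {x} = R `` {y} \<longleftrightarrow> (W x, W y) \<in> eventually_equal" if "x \<in> V" "y \<in> V" for x y
    using eq_equiv_class_iff[OF equiv that] that by (simp add: R_def)
  have cong: "(W y, W y') \<in> eventually_equal"
    if "(x, a, y) \<in> E" "(x', a, y') \<in> E" "(W x, W x') \<in> eventually_equal" for x x' a y y'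
    using edges[OF that(1)] edges[OF that(2)] eventually_equal_dest[OF that(3)] by simp
  have det: "deterministic_edges (quotient_edges E R)"
    unfolding deterministic_edges_def
  proof (intro allI impI)
    fix X a Y Z assume "(X, a, Y) \<in> quotient_edges E R" "(X, a, Z) \<in> quotient_edges E R"
    then obtain x y x' z where e: "(x, a, y) \<in> E" "X = R `` {x}" "Y = R `` {y}"
      "(x', a, z) \<in> E" "X = R `` {x'}" "Z = R `` {z}"
      unfolding quotient_edges_iff by blast
    have V: "x \<in> V" "x' \<in> V" "y \<in> V" "z \<in> V" using edges[OF e(1)] edges[OF e(4)] by auto
    have "(W x, W x') \<in> eventually_equal" using class_eq[OF V(1,2)] e(2,5) by simp
    then have "(W y, W z) \<in> eventually_equal" by (rule cong[OF e(1,4)])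
    then show "Y = Z" using class_eq[OF V(3,4)] e(3,6) by simp
  qed
  have "folded_edges m (quotient_edges E R)"
    unfolding folded_edges_def
  proof (intro allI impI)
    fix X X'
    assume father: "father_vertex m (quotient_edges E R) X" "father_vertex m (quotient_edges E R) X'"
      and same: "\<forall>a<m. \<forall>Z. (X, a, Z) \<in> quotient_edges E R \<longleftrightarrow> (X', a, Z) \<in> quotient_edges E R"
    have "0 < m" using two_le by simp
    have cls: "\<exists>x. x \<in> V \<and> X = R `` {x}" if "father_vertex m (quotient_edges E R) X" for X
      using that \<open>0 < m\<close> edges unfolding father_vertex_def quotient_edges_iff by blast
    obtain x x' where x: "x \<in> V" "X = R `` {x}" and x': "x' \<in> V" "X' = R `` {x'}"
      using cls[OF father(1)] cls[OF father(2)] by blast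
    have "(W x, W x') \<in> eventually_equal"
    proof (rule eventually_equal_folded)
      fix a assume a: "a < m"
      obtain Y where Y: "(X, a, Y) \<in> quotient_edges E R" "(X', a, Y) \<in> quotient_edges E R"
        using father(1) same a unfolding father_vertex_def by blast
      \<comment> \<open>The edges of one class may leave from a different vertex for each letter.
        The child seen at \<open>y1\<close> is therefore carried over to the child of
        \<open>W x\<close> by the congruence property, and likewise for \<open>y2\<close> and
        \<open>x'\<close>.\<close>
      obtain y1 z1 where 1: "(y1, a, z1) \<in> E" "X = R `` {y1}" "Y = R `` {z1}"
        using Y(1) unfolding quotient_edges_iff by blast
      obtain y2 z2 where 2: "(y2, a, z2) \<in> E" "X' = R `` {y2}" "Y = R `` {z2}"
        using Y(2) unfolding quotient_edges_iff by blast
      have V: "y1 \<in> V" "z1 \<in> V" "y2 \<in> V" "z2 \<in> V"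
        using edges[OF 1(1)] edges[OF 2(1)] by auto
      have "(W z1, W z2) \<in> eventually_equal" "(W x, W y1) \<in> eventually_equal"
        "(W y2, W x') \<in> eventually_equal"
        using class_eq[OF V(2,4)] class_eq[OF x(1) V(1)] class_eq[OF V(3) x'(1)] 1 2 x x' by auto
      then have "(dest (W y1) [a], dest (W y2) [a]) \<in> eventually_equal"
        "(dest (W x) [a], dest (W y1) [a]) \<in> eventually_equal"
        "(dest (W y2) [a], dest (W x') [a]) \<in> eventually_equal"
        using edges[OF 1(1)] edges[OF 2(1)] eventually_equal_dest[OF _ a] by auto
      then show "(dest (W x) [a], dest (W x') [a]) \<in> eventually_equal"
        by (blast intro: trans)
    qed (use W x x' in auto)
    then show "X = X'" using class_eq x x' by simp
  qed
  moreover have "I \<subseteq> R" using I by (auto simp: R_def)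
  ultimately show ?thesis
    using equiv det unfolding admissible_def R_def by simp
qed

lemma automaton_edges_iff:
  "(p, a, q) \<in> automaton_edges m P \<longleftrightarrow> p \<in> states P \<and> a < m \<and> q = dest p [a]"
  using trans_eq by (auto simp: automaton_edges_def)

lemma admissible_eventually_equal:
  "admissible m (states P) (automaton_edges m P) {} eventually_equal"
proof -
  have *: "{(x, y). x \<in> states P \<and> y \<in> states P \<and> (x, y) \<in> eventually_equal} = eventually_equal"
    using equiv_eventually_equal by (auto simp: equiv_def)
  have "admissible m (states P) (automaton_edges m P) {}
      {(x, y). x \<in> states P \<and> y \<in> states P \<and> (x, y) \<in> eventually_equal}"
    by (rule admissible_state_map) (auto simp: automaton_edges_iff dest_in_states)
  then show ?thesis by (simp only: *)
qed

text \<open>All states of a full automaton are fathers, so an admissible relation that identifies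
  the children of two states gives their classes the same outgoing edges and must identify the
  states too.\<close>

lemma folding_relation_automaton:
  "folding_relation m (states P) (automaton_edges m P) {} = eventually_equal"
proof (rule folding_relation_eqI[OF admissible_eventually_equal])
  fix R assume R: "admissible m (states P) (automaton_edges m P) {} R"
  let ?Q = "quotient_edges (automaton_edges m P) R"
  have equiv: "equiv (states P) R" and det: "deterministic_edges ?Q" and folded: "folded_edges m ?Q"
    using R by (auto simp: admissible_def)
  have edge: "(R `` {p}, a, R `` {dest p [a]}) \<in> ?Q" if "p \<in> states P" "a < m" for p a
    using that by (intro quotient_edgesI) (simp add: automaton_edges_iff)
  show "eventually_equal \<subseteq> R"
  proof (rule eventually_equal_least)
    show "(p, p) \<in> R" if "p \<in> states P" for p
      using equiv_class_self[OF equiv that] by simp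
    fix p q assume pq: "p \<in> states P" "q \<in> states P"
      and children: "\<And>a. a < m \<Longrightarrow> (dest p [a], dest q [a]) \<in> R"
    have eq: "R `` {dest p [a]} = R `` {dest q [a]}" if "a < m" for a
      using equiv_class_eq[OF equiv children[OF that]] .
    have "(R `` {p}, a, Z) \<in> ?Q \<longleftrightarrow> (R `` {q}, a, Z) \<in> ?Q" if "a < m" for a Z
      using edge[OF pq(1) that] edge[OF pq(2) that] eq[OF that] det
      unfolding deterministic_edges_def by metis
    moreover have "father_vertex m ?Q (R `` {p})" "father_vertex m ?Q (R `` {q})"
      using edge pq unfolding father_vertex_def by blast+
    ultimately have "R `` {p} = R `` {q}"
      using folded unfolding folded_edges_def by blast
    then show "(p, q) \<in> R" using eq_equiv_class[OF _ equiv pq(2)] by blast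
  qed
qed

end

section \<open>The core of a full pre-core\<close>

definition extended_step ::
  "('x \<times> nat \<times> 'x) set \<Rightarrow> 'x \<times> nat list \<Rightarrow> nat \<Rightarrow> 'x \<times> nat list" where
  "extended_step Q s a =
     (if snd s = [] \<and> (\<exists>Y. (fst s, a, Y) \<in> Q) then (THE Y. (fst s, a, Y) \<in> Q, [])
      else (fst s, snd s @ [a]))"

text \<open>
  This is a run in the graph \<open>Q\<close> with a full infinite tree hung onto every missing edge: the
  second component is the position in the hanging tree.
\<close>

definition extended_run :: "('x \<times> nat \<times> 'x) set \<Rightarrow> 'x \<Rightarrow> nat list \<Rightarrow> 'x \<times> nat list" where
  "extended_run Q X w = foldl (extended_step Q) (X, []) w"

lemma extended_run_Nil: "extended_run Q X [] = (X, [])"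
  by (simp add: extended_run_def)

lemma extended_run_snoc: "extended_run Q X (w @ [a]) = extended_step Q (extended_run Q X w) a"
  by (simp add: extended_run_def)

lemma extended_step_edge:
  assumes "deterministic_edges Q" and "(X, a, Y) \<in> Q"
  shows "extended_step Q (X, []) a = (Y, [])"
proof -
  have "(THE Y. (X, a, Y) \<in> Q) = Y"
    using assms unfolding deterministic_edges_def by (intro the_equality) metis+
  then show ?thesis using assms(2) by (auto simp: extended_step_def)
qed

text \<open>Once outside the graph, the run records every letter read, so different words leaving by
  the same missing edge end in different states.\<close>

lemma extended_run_stuck:
  assumes "extended_run Q X w = (Y, [])" and "\<nexists>Z. (Y, a, Z) \<in> Q"
  shows "extended_run Q X (w @ a # c) = (Y, a # c)"
proof (induction c rule: rev_induct)
  case Nil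
  then show ?case using assms by (simp add: extended_run_snoc extended_step_def)
next
  case (snoc b c)
  then show ?case
    using extended_run_snoc[of Q X "w @ a # c" b] by (simp add: extended_step_def)
qed

fun vertex_word :: "core_vertex \<Rightarrow> nat list" where
  "vertex_word Base = []"
| "vertex_word (Source d w) = w"
| "vertex_word (Target d w) = w"

lemma tree_vertices_append: "w @ v \<in> tree_vertices U \<Longrightarrow> w \<in> tree_vertices U"
  unfolding tree_vertices_def by (auto dest: append_prefixD)

lemma leaf_in_tree_vertices: "u \<in> U \<Longrightarrow> u \<in> tree_vertices U"
  unfolding tree_vertices_def by auto

lemma tree_vertices_words: "U \<subseteq> words n \<Longrightarrow> tree_vertices U \<subseteq> words n"
  unfolding tree_vertices_def Sublist.prefix_def by auto

text \<open>A complete code is nonempty because it covers the zero sequence, so its tree has a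
  root.\<close>

lemma Nil_in_tree_vertices:
  assumes "0 < n" "complete_prefix_code n U"
  shows "[] \<in> tree_vertices U"
proof -
  have "(\<lambda>_. 0) \<in> (\<Union>u\<in>U. cylinder n u)"
    using assms by (simp add: complete_prefix_code_def cantor_def)
  then show ?thesis by (auto simp: tree_vertices_def)
qed

text \<open>\<open>P\<close> stands for the pullback automaton. \<open>T\<close> is an arbitrary
  generating set, so the result holds for every presentation of the core.\<close>

locale finite_pre_core = full_automaton m P for m :: nat and P :: "'q automaton" +
  fixes T :: "((nat \<Rightarrow> nat) \<Rightarrow> (nat \<Rightarrow> nat)) set"
  assumes existence: "existence_property m P"
    and finite_states: "finite (states P)"
    and generators: "generates m T (diagram_group m P)"
begin

abbreviation "diagrams \<equiv> reduced_diagrams m T"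
abbreviation "vertices \<equiv> core_vertices diagrams"
abbreviation "edges \<equiv> core_edges diagrams"
abbreviation "identifications \<equiv> core_identifications diagrams"

abbreviation vertex_state :: "core_vertex \<Rightarrow> 'q" where
  "vertex_state x \<equiv> state_of (vertex_word x)"

lemma generators_thompson: "T \<subseteq> thompson m"
  using generators by (simp add: generates_def)

lemma diagram_codes:
  assumes "d \<in> diagrams"
  shows "complete_prefix_code m (fst ` set d)" "complete_prefix_code m (snd ` set d)"
  using assms by (auto simp: reduced_diagrams_def tree_diagram_of_def tree_diagram_def)

lemma diagram_tree_words:
  assumes "d \<in> diagrams"
  shows "tree_vertices (fst ` set d) \<subseteq> words m" "tree_vertices (snd ` set d) \<subseteq> words m"
  using diagram_codes[OF assms] by (auto simp: complete_prefix_code_def dest: tree_vertices_words)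

lemma Source_vertex: "Source d w \<in> vertices \<longleftrightarrow> d \<in> diagrams \<and> w \<in> tree_vertices (fst ` set d)"
  and Target_vertex: "Target d w \<in> vertices \<longleftrightarrow> d \<in> diagrams \<and> w \<in> tree_vertices (snd ` set d)"
  and Base_vertex: "Base \<in> vertices"
  by (auto simp: core_vertices_def)

lemma vertex_word_in_words: "x \<in> vertices \<Longrightarrow> vertex_word x \<in> words m"
  using diagram_tree_words by (cases x) (auto simp: Source_vertex Target_vertex)

lemma vertex_state_in_states: "x \<in> vertices \<Longrightarrow> vertex_state x \<in> states P"
  by (intro dest_in_states root_in_states vertex_word_in_words)

lemma edge_vertices:
  assumes "(x, a, y) \<in> edges"
  shows "x \<in> vertices \<and> y \<in> vertices \<and> vertex_word y = vertex_word x @ [a]"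
  using assms unfolding core_edges_def
  by (auto simp: Source_vertex Target_vertex dest: tree_vertices_append)

lemma edge_state:
  assumes "(x, a, y) \<in> edges"
  shows "x \<in> vertices \<and> y \<in> vertices \<and> a < m \<and> vertex_state y = dest (vertex_state x) [a]"
proof -
  have *: "x \<in> vertices" "y \<in> vertices" "vertex_word y = vertex_word x @ [a]"
    using edge_vertices[OF assms] by auto
  moreover have "a < m" using vertex_word_in_words[OF *(2)] *(3) by simp
  ultimately show ?thesis
    using dest_append[OF root_in_states vertex_word_in_words[OF *(1)], of "[a]"] by simp
qed

text \<open>Acceptance of a generator asks only for some accepted diagram, which may be finer than
  the reduced one. Paired leaves of the reduced diagram thus reach states that are guaranteed to
  agree only after long enough extensions.\<close>

lemma leaf_states:
  assumes "d \<in> diagrams" "(u, v) \<in> set d"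
  shows "(state_of u, state_of v) \<in> eventually_equal"
proof -
  obtain t where t: "t \<in> T" "tree_diagram_of m t d"
    using assms(1) by (auto simp: reduced_diagrams_def)
  have "u \<in> fst ` set d" "v \<in> snd ` set d" using assms(2) by force+
  then have uv: "u \<in> words m" "v \<in> words m"
    using diagram_codes[OF assms(1)] by (auto simp: complete_prefix_code_def)
  have "t \<in> generate (thompson_group m) T" using t(1) by (rule generate.incl)
  then have "t \<in> diagram_group m P" using generators by (simp add: generates_def)
  then have acc: "locally_accepted m (same_state P) t" by (rule diagram_group_locally_accepted)
  have branch: "has_branch_pair m t u v" using t(2) assms(2) by (auto simp: tree_diagram_of_def)
  obtain M where M: "\<And>e. e \<in> words m \<Longrightarrow> M \<le> length e \<Longrightarrow> same_state P (u @ e) (v @ e)"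
  proof (rule right_invariant_fan[OF right_invariant_same_state uv])
    show "\<exists>k. same_state P (u @ initial k \<omega>) (v @ initial k \<omega>)" if "\<omega> \<in> cantor m" for \<omega>
      using locally_accepted_refine[OF two_le acc right_invariant_same_state branch uv that] by blast
  qed blast
  show ?thesis
  proof (rule eventually_equalI[where N = M])
    fix e assume e: "e \<in> words m" "M \<le> length e"
    then have "state_of (u @ e) = state_of (v @ e)"
      using M[OF e] uv by (simp add: same_state_iff)
    then show "dest (state_of u) e = dest (state_of v) e"
      using dest_append[OF root_in_states uv(1), of e] dest_append[OF root_in_states uv(2), of e] by simp
  qed (use uv root_in_states in \<open>auto intro: dest_in_states\<close>)
qed

lemma eventually_equal_refl: "q \<in> states P \<Longrightarrow> (q, q) \<in> eventually_equal"
  by (rule eventually_equalI[where N = 0]) simp_all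

lemma identification_vertices:
  assumes "(x, y) \<in> identifications"
  shows "x \<in> vertices \<and> y \<in> vertices"
proof -
  have "[] \<in> tree_vertices (fst ` set d)" "[] \<in> tree_vertices (snd ` set d)" if "d \<in> diagrams" for d
    using Nil_in_tree_vertices[OF _ diagram_codes(1)[OF that]]
      Nil_in_tree_vertices[OF _ diagram_codes(2)[OF that]] two_le by simp_all
  moreover have "u \<in> tree_vertices (fst ` set d)" "v \<in> tree_vertices (snd ` set d)"
    if "(u, v) \<in> set d" for u v d
    using that by (force intro: leaf_in_tree_vertices)+
  ultimately show ?thesis
    using assms by (auto simp: core_identifications_def Source_vertex Target_vertex Base_vertex)
qed

lemma identification_states:
  assumes "(x, y) \<in> identifications"
  shows "(vertex_state x, vertex_state y) \<in> eventually_equal"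
  using assms leaf_states eventually_equal_refl[OF root_in_states]
  by (auto simp: core_identifications_def)

definition vertex_relation :: "(core_vertex \<times> core_vertex) set" where
  "vertex_relation = {(x, y). x \<in> vertices \<and> y \<in> vertices \<and>
     (vertex_state x, vertex_state y) \<in> eventually_equal}"

lemma admissible_vertex_relation: "admissible m vertices edges identifications vertex_relation"
  unfolding vertex_relation_def
  by (rule admissible_state_map)
    (use edge_state vertex_state_in_states identification_vertices identification_states in blast)+

section \<open>An arbitrary folded quotient of the trees of the generators\<close>

context
  fixes R :: "(core_vertex \<times> core_vertex) set"
  assumes adm: "admissible m vertices edges identifications R"
begin

abbreviation "graph \<equiv> quotient_edges edges R"
abbreviation "hat w \<equiv> extended_run graph (R `` {Base}) w"

lemma equiv_R: "equiv vertices R" and det: "deterministic_edges graph"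
  and folded: "folded_edges m graph" and identified: "identifications \<subseteq> R"
  using adm by (simp_all add: admissible_def)

lemma identified_class: "(x, y) \<in> identifications \<Longrightarrow> R `` {x} = R `` {y}"
  using identified equiv_class_eq[OF equiv_R] by blast

lemma hat_edge:
  assumes "(x, a, y) \<in> edges" and "hat w = (R `` {x}, [])"
  shows "hat (w @ [a]) = (R `` {y}, [])"
  using assms(2) extended_step_edge[OF det quotient_edgesI[OF assms(1)]]
  by (simp add: extended_run_snoc)

text \<open>Both trees of each diagram start at \<open>Base\<close> and all their edges survive in
  the quotient, so reading the word of a vertex from the root never leaves the graph.\<close>

lemma hat_vertex:
  assumes "x \<in> vertices"
  shows "hat (vertex_word x) = (R `` {x}, [])"
proof (cases x)
  case Base
  then show ?thesis by (simp add: extended_run_Nil)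
next
  case (Source d w)
  have "Source d w \<in> vertices \<Longrightarrow> hat w = (R `` {Source d w}, [])"
  proof (induction w rule: rev_induct)
    case Nil
    then have "(Base, Source d []) \<in> identifications"
      by (auto simp: core_identifications_def Source_vertex)
    then show ?case using identified_class extended_run_Nil by metis
  next
    case (snoc a w)
    then have "(Source d w, a, Source d (w @ [a])) \<in> edges" "Source d w \<in> vertices"
      by (auto simp: core_edges_def Source_vertex dest: tree_vertices_append)
    then show ?case using snoc.IH hat_edge by blast
  qed
  then show ?thesis using assms Source by simp
next
  case (Target d w)
  have "Target d w \<in> vertices \<Longrightarrow> hat w = (R `` {Target d w}, [])"
  proof (induction w rule: rev_induct)
    case Nil
    then have "(Base, Target d []) \<in> identifications"
      by (auto simp: core_identifications_def Target_vertex)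
    then show ?case using identified_class extended_run_Nil by metis
  next
    case (snoc a w)
    then have "(Target d w, a, Target d (w @ [a])) \<in> edges" "Target d w \<in> vertices"
      by (auto simp: core_edges_def Target_vertex dest: tree_vertices_append)
    then show ?case using snoc.IH hat_edge by blast
  qed
  then show ?thesis using assms Target by simp
qed

lemma hat_generator:
  assumes "t \<in> T"
  shows "locally_accepted m (\<lambda>u v. hat u = hat v) t"
proof -
  obtain d where d: "tree_diagram_of m t d" "reduced_diagram m d"
    using reduced_diagram_exists[OF two_le] assms generators_thompson by blast
  then have "d \<in> diagrams" using assms by (auto simp: reduced_diagrams_def)
  show ?thesis
  proof (rule diagram_locally_accepted[OF d(1)])
    fix u v assume "(u, v) \<in> set d"
    then have id: "(Source d u, Target d v) \<in> identifications"
      using \<open>d \<in> diagrams\<close> by (auto simp: core_identifications_def)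
    then show "hat u = hat v"
      using identification_vertices[OF id] hat_vertex[of "Source d u"] hat_vertex[of "Target d v"]
        identified_class[OF id] by simp
  qed
qed

text \<open>This is the purpose of the hanging trees: the extended run is total, so equal runs stay
  equal even after a letter for which the graph has no edge.\<close>

lemma right_invariant_hat: "right_invariant m (\<lambda>u v. hat u = hat v)"
  by (simp add: right_invariant_def extended_run_snoc)

text \<open>Equality of \<open>hat\<close> is an equivalence preserved by extension, so acceptance
  spreads from the generators to the whole group.\<close>

lemma hat_group:
  assumes "f \<in> diagram_group m P"
  shows "locally_accepted m (\<lambda>u v. hat u = hat v) f"
  by (rule locally_accepted_generate[OF two_le generators_thompson hat_generator right_invariant_hat])
    (use assms generators in \<open>auto simp: generates_def\<close>)

text \<open>The link from \<open>P\<close> to the quotient: the existence property turns a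
  coincidence of states into a group element, and its acceptance by \<open>hat\<close> yields equal
  runs further down along every point.\<close>

lemma hat_refine:
  assumes uv: "u \<in> words m" "v \<in> words m" "state_of u = state_of v" and \<omega>: "\<omega> \<in> cantor m"
  obtains k where "hat (u @ initial k \<omega>) = hat (v @ initial k \<omega>)"
proof -
  have "same_state P u v" using uv by (simp add: same_state_iff)
  then obtain f where "f \<in> diagram_group m P" "has_branch_pair m f u v"
    using existence uv(1,2) unfolding existence_property_def by blast
  then show thesis
    using locally_accepted_refine[OF two_le hat_group right_invariant_hat _ uv(1,2) \<omega>] that by blast
qed

text \<open>
  A word that leaves the graph has infinitely many extensions, all in distinct states of the
  extended run. Two of them share a state of the finite automaton \<open>P\<close>, so that the existence
  property yields a group element which the extended run does not accept.
\<close>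

lemma hat_total:
  assumes w: "w \<in> words m" "hat w = (X, [])" and a: "a < m"
  shows "\<exists>Y. (X, a, Y) \<in> graph"
proof (rule ccontr)
  assume stuck: "\<nexists>Y. (X, a, Y) \<in> graph"
  define c where "c k = a # replicate k 0" for k :: nat
  have c: "w @ c k \<in> words m" for k
    using w a two_le by (simp add: c_def replicate_in_words)
  have "range (\<lambda>k. state_of (w @ c k)) \<subseteq> states P"
    using c root_in_states by (auto intro: dest_in_states)
  then have "\<not> inj (\<lambda>k. state_of (w @ c k))"
    using finite_states finite_subset range_inj_infinite by blast
  then obtain j k where jk: "j \<noteq> k" "state_of (w @ c j) = state_of (w @ c k)"
    unfolding inj_def by blast
  have "(\<lambda>_. 0) \<in> cantor m" using zero_in_cantor[OF two_le] .
  then obtain i where "hat ((w @ c j) @ initial i (\<lambda>_. 0)) = hat ((w @ c k) @ initial i (\<lambda>_. 0))"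
    using hat_refine[OF c c jk(2)] by blast
  \<comment> \<open>Both runs have left the graph, so their second components are the words read
    since then.\<close>
  then have "c j @ initial i (\<lambda>_. 0) = c k @ initial i (\<lambda>_. 0)"
    using extended_run_stuck[OF w(2) stuck] by (simp add: c_def)
  then have "c j = c k" by simp
  then show False using jk(1) by (metis c_def length_Cons length_replicate nat.inject)
qed

lemma hat_full:
  assumes "w \<in> words m"
  obtains X where "hat w = (X, [])" "father_vertex m graph X"
    "\<And>a Y. (X, a, Y) \<in> graph \<Longrightarrow> hat (w @ [a]) = (Y, [])"
proof -
  have "\<exists>X. hat w = (X, [])"
    using assms
  proof (induction w rule: rev_induct)
    case (snoc a w)
    then obtain X where X: "hat w = (X, [])" by auto
    obtain Y where "(X, a, Y) \<in> graph" using hat_total[OF _ X, of a] snoc.prems by auto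
    with X show ?case by (simp add: extended_run_snoc extended_step_edge[OF det])
  qed (simp add: extended_run_Nil)
  then obtain X where X: "hat w = (X, [])" ..
  show thesis
  proof (rule that[OF X])
    show "father_vertex m graph X" using hat_total[OF assms X] by (simp add: father_vertex_def)
    show "hat (w @ [a]) = (Y, [])" if "(X, a, Y) \<in> graph" for a Y
      using X extended_step_edge[OF det that] by (simp add: extended_run_snoc)
  qed
qed

text \<open>Foldedness compares father vertices only. Both endpoints are such vertices because no
  edge is missing at a class reached by a word.\<close>

lemma hat_folded:
  assumes uv: "u \<in> words m" "v \<in> words m" and children: "\<And>a. a < m \<Longrightarrow> hat (u @ [a]) = hat (v @ [a])"
  shows "hat u = hat v"
proof -
  obtain X where X: "hat u = (X, [])" "father_vertex m graph X"
    "\<And>a Z. (X, a, Z) \<in> graph \<Longrightarrow> hat (u @ [a]) = (Z, [])"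
    using hat_full[OF uv(1)] by blast
  obtain Y where Y: "hat v = (Y, [])" "father_vertex m graph Y"
    "\<And>a Z. (Y, a, Z) \<in> graph \<Longrightarrow> hat (v @ [a]) = (Z, [])"
    using hat_full[OF uv(2)] by blast
  have "(X, a, Z) \<in> graph \<longleftrightarrow> (Y, a, Z) \<in> graph" if a: "a < m" for a Z
  proof -
    obtain X' Y' where *: "(X, a, X') \<in> graph" "(Y, a, Y') \<in> graph"
      using X(2) Y(2) a unfolding father_vertex_def by blast
    then have "X' = Y'" using X(3)[OF *(1)] Y(3)[OF *(2)] children[OF a] by simp
    then show ?thesis using * det unfolding deterministic_edges_def by blast
  qed
  then have "X = Y" using folded X(2) Y(2) unfolding folded_edges_def by blast
  then show ?thesis using X(1) Y(1) by simp
qed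

text \<open>The extension length is lowered one letter at a time, with one application of foldedness
  for each level.\<close>

lemma hat_folded_eventually:
  assumes "\<And>e. e \<in> words m \<Longrightarrow> M \<le> length e \<Longrightarrow> hat (u @ e) = hat (v @ e)"
    and uv: "u \<in> words m" "v \<in> words m"
  shows "hat u = hat v"
  using assms
proof (induction M arbitrary: u v)
  case 0
  from "0.prems"(1)[of "[]"] show ?case by simp
next
  case (Suc M)
  show ?case
  proof (rule hat_folded[OF Suc.prems(2,3)])
    fix a assume a: "a < m"
    show "hat (u @ [a]) = hat (v @ [a])"
    proof (rule Suc.IH)
      fix e assume e: "e \<in> words m" "M \<le> length e"
      then show "hat ((u @ [a]) @ e) = hat ((v @ [a]) @ e)"
        using Suc.prems(1)[of "a # e"] a by simp
    qed (use a Suc.prems(2,3) in simp_all)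
  qed
qed

lemma vertex_relation_least: "vertex_relation \<subseteq> R"
proof
  fix p assume "p \<in> vertex_relation"
  then obtain x y where p: "p = (x, y)" and xy: "x \<in> vertices" "y \<in> vertices"
    and ev: "(vertex_state x, vertex_state y) \<in> eventually_equal"
    by (auto simp: vertex_relation_def)
  define u v where "u = vertex_word x" and "v = vertex_word y"
  have uv: "u \<in> words m" "v \<in> words m"
    using xy vertex_word_in_words by (simp_all add: u_def v_def)
  obtain N where N: "\<forall>w\<in>words m. N \<le> length w \<longrightarrow> dest (state_of u) w = dest (state_of v) w"
    using ev unfolding u_def v_def by (rule eventually_equalE)
  obtain M where "\<And>e. e \<in> words m \<Longrightarrow> M \<le> length e \<Longrightarrow> hat (u @ e) = hat (v @ e)"
  proof (rule right_invariant_fan[OF right_invariant_hat uv])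
    fix \<omega> assume \<omega>: "\<omega> \<in> cantor m"
    \<comment> \<open>The first \<open>N\<close> letters lead both words to the same state of
      \<open>P\<close>; only then does the existence property apply, and it yields equal runs after
      \<open>k\<close> further letters.\<close>
    let ?w = "initial N \<omega>" and ?\<eta> = "Omega_Words_Fun.suffix N \<omega>"
    have w: "?w \<in> words m" using \<omega> by simp
    have "dest (state_of u) ?w = dest (state_of v) ?w" using bspec[OF N w] by simp
    then have "state_of (u @ ?w) = state_of (v @ ?w)"
      using dest_append[OF root_in_states uv(1)] dest_append[OF root_in_states uv(2)] by simp
    moreover have "u @ ?w \<in> words m" "v @ ?w \<in> words m" using uv w by simp_all
    moreover have "?\<eta> \<in> cantor m" using \<omega> by simp
    ultimately obtain k where "hat ((u @ ?w) @ initial k ?\<eta>) = hat ((v @ ?w) @ initial k ?\<eta>)"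
      using hat_refine by blast
    moreover have "?w @ initial k ?\<eta> = initial (N + k) \<omega>"
      by (simp add: subsequence_append)
    ultimately show "\<exists>k. hat (u @ initial k \<omega>) = hat (v @ initial k \<omega>)"
      by (metis append_assoc)
  qed blast
  then have "hat u = hat v" using hat_folded_eventually uv by blast
  then have "R `` {x} = R `` {y}"
    using hat_vertex[OF xy(1)] hat_vertex[OF xy(2)] by (simp add: u_def v_def)
  then show "p \<in> R" using eq_equiv_class[OF _ equiv_R xy(2)] p by blast
qed

end

section \<open>Comparison of the core with the folded automaton\<close>

lemma core_folding_relation: "folding_relation m vertices edges identifications = vertex_relation"
  by (rule folding_relation_eqI[OF admissible_vertex_relation vertex_relation_least])

lemma vertex_relation_class_eq:
  assumes "x \<in> vertices" "y \<in> vertices"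
  shows "vertex_relation `` {x} = vertex_relation `` {y} \<longleftrightarrow>
    (vertex_state x, vertex_state y) \<in> eventually_equal"
  using eq_equiv_class_iff[OF equiv_R[OF admissible_vertex_relation] assms] assms
  by (simp add: vertex_relation_def)

text \<open>A word usually leaves the finite trees of the generators, but in the quotient it can be
  followed forever, changing the representative vertex whenever the next edge starts at another one.
  Hence every state of \<open>P\<close> is represented by a vertex up to
  \<open>eventually_equal\<close>.\<close>

lemma core_vertex_for_word:
  assumes "w \<in> words m"
  shows "\<exists>x\<in>vertices. extended_run (quotient_edges edges vertex_relation) (vertex_relation `` {Base}) w
      = (vertex_relation `` {x}, []) \<and> (vertex_state x, state_of w) \<in> eventually_equal"
  using assms
proof (induction w rule: rev_induct)
  case Nil
  then show ?case
    using Base_vertex eventually_equal_refl[OF root_in_states] by (auto simp: extended_run_Nil)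
next
  case (snoc a w)
  let ?hat = "extended_run (quotient_edges edges vertex_relation) (vertex_relation `` {Base})"
  have w: "w \<in> words m" "a < m" using snoc.prems by auto
  obtain x where x: "x \<in> vertices" "?hat w = (vertex_relation `` {x}, [])"
    "(vertex_state x, state_of w) \<in> eventually_equal"
    using snoc.IH[OF w(1)] by blast
  obtain Y where "(vertex_relation `` {x}, a, Y) \<in> quotient_edges edges vertex_relation"
    using hat_total[OF admissible_vertex_relation w(1) x(2) w(2)] by blast
  then obtain x' y where y: "(x', a, y) \<in> edges" "vertex_relation `` {x} = vertex_relation `` {x'}"
    unfolding quotient_edges_iff by blast
  have "x' \<in> vertices" "y \<in> vertices" and y_state: "vertex_state y = dest (vertex_state x') [a]"
    using edge_state[OF y(1)] by auto
  have "(vertex_state x', vertex_state x) \<in> eventually_equal"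
    using vertex_relation_class_eq[OF \<open>x' \<in> vertices\<close> x(1)] y(2) by simp
  then have "(vertex_state x', state_of w) \<in> eventually_equal"
    using x(3) equiv_eventually_equal unfolding equiv_def by (blast dest: transD)
  then have "(vertex_state y, state_of (w @ [a])) \<in> eventually_equal"
    using eventually_equal_dest[OF _ w(2)] y_state dest_append[OF root_in_states w(1), of "[a]"] by simp
  moreover have "?hat (w @ [a]) = (vertex_relation `` {y}, [])"
    using hat_edge[OF admissible_vertex_relation y(1), of w] x(2) y(2) by simp
  ultimately show ?case using \<open>y \<in> vertices\<close> by blast
qed

lemma core_vertex_for_state:
  assumes "q \<in> states P"
  obtains x where "x \<in> vertices" "(vertex_state x, q) \<in> eventually_equal"
  using reachable[OF assms] core_vertex_for_word that by blast

lemma vertex_edge: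
  assumes x: "x \<in> vertices" and a: "a < m"
  obtains x' y where "(x', a, y) \<in> edges" "vertex_relation `` {x'} = vertex_relation `` {x}"
proof -
  obtain Y where "(vertex_relation `` {x}, a, Y) \<in> quotient_edges edges vertex_relation"
    using hat_total[OF admissible_vertex_relation vertex_word_in_words[OF x]
        hat_vertex[OF admissible_vertex_relation x] a] by blast
  then show thesis using that unfolding quotient_edges_iff by metis
qed

theorem folded_quotient_iso_core: "automaton_iso m (folded_quotient m P) (core m T)"
proof -
  let ?ev = "eventually_equal" and ?R = "vertex_relation"
  let ?F = "quotient_automaton (states P) (automaton_edges m P) (root P) ?ev"
  let ?C = "quotient_automaton vertices edges Base ?R"
  \<comment> \<open>\<open>g\<close> takes preimages under \<open>vertex_state\<close>. By
    \<open>F_class\<close> every class of states is met, so these preimages are nonempty and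
    determine the class.\<close>
  define g where "g Z = {x \<in> vertices. vertex_state x \<in> Z}" for Z
  have F: "folded_quotient m P = ?F"
    by (simp add: folded_quotient_def folding_relation_automaton)
  have C: "core m T = ?C"
    by (simp add: core_def Let_def core_folding_relation)
  have g: "g (?ev `` {vertex_state x}) = ?R `` {x}" if "x \<in> vertices" for x
    using that by (auto simp: g_def vertex_relation_def)
  have F_class: "\<exists>x\<in>vertices. Z = ?ev `` {vertex_state x}" if Z: "Z \<in> states P // ?ev" for Z
  proof -
    obtain q where q: "Z = ?ev `` {q}" "q \<in> states P" using Z by (rule quotientE)
    obtain x where "x \<in> vertices" "(vertex_state x, q) \<in> ?ev"
      using core_vertex_for_state[OF q(2)] .
    then show ?thesis using q(1) equiv_class_eq[OF equiv_eventually_equal] by blast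
  qed
  have ev_class: "?ev `` {vertex_state x} = ?ev `` {vertex_state y} \<longleftrightarrow> ?R `` {x} = ?R `` {y}"
    if "x \<in> vertices" "y \<in> vertices" for x y
    using that eq_equiv_class_iff[OF equiv_eventually_equal] vertex_state_in_states
      vertex_relation_class_eq by simp
  have "bij_betw g (states P // ?ev) (vertices // ?R)"
  proof (rule bij_betw_imageI)
    show "inj_on g (states P // ?ev)"
    proof (rule inj_onI)
      fix X Y assume "X \<in> states P // ?ev" "Y \<in> states P // ?ev" "g X = g Y"
      moreover then obtain x y where "x \<in> vertices" "X = ?ev `` {vertex_state x}"
        "y \<in> vertices" "Y = ?ev `` {vertex_state y}"
        using F_class by metis
      ultimately show "X = Y" using g ev_class by simp
    qed
    show "g ` (states P // ?ev) = vertices // ?R"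
    proof (intro equalityI subsetI)
      fix X assume "X \<in> g ` (states P // ?ev)"
      then obtain x where "x \<in> vertices" "X = ?R `` {x}" using F_class g by blast
      then show "X \<in> vertices // ?R" by (simp add: quotientI)
    next
      fix X assume "X \<in> vertices // ?R"
      then obtain x where x: "X = ?R `` {x}" "x \<in> vertices" by (rule quotientE)
      then have "X = g (?ev `` {vertex_state x})" using g by simp
      moreover have "?ev `` {vertex_state x} \<in> states P // ?ev"
        using vertex_state_in_states[OF x(2)] by (rule quotientI)
      ultimately show "X \<in> g ` (states P // ?ev)" by blast
    qed
  qed
  moreover have "g (?ev `` {root P}) = ?R `` {Base}"
    using g[OF Base_vertex] by simp
  moreover have "trans ?C (g Z) a = map_option g (trans ?F Z a)"
    if Z: "Z \<in> states P // ?ev" and a: "a < m" for Z a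
  proof -
    obtain x where x: "x \<in> vertices" "Z = ?ev `` {vertex_state x}" using F_class[OF Z] by blast
    obtain x' y where e: "(x', a, y) \<in> edges" "?R `` {x'} = ?R `` {x}"
      using vertex_edge[OF x(1) a] .
    have x': "x' \<in> vertices" "y \<in> vertices" "vertex_state y = dest (vertex_state x') [a]"
      using edge_state[OF e(1)] by auto
    have Z': "Z = ?ev `` {vertex_state x'}" using ev_class[OF x'(1) x(1)] e(2) x(2) by simp
    have "(vertex_state x', a, vertex_state y) \<in> automaton_edges m P"
      using vertex_state_in_states[OF x'(1)] a x'(3) by (simp add: automaton_edges_iff)
    then have "(Z, a, ?ev `` {vertex_state y}) \<in> quotient_edges (automaton_edges m P) ?ev"
      unfolding Z' by (rule quotient_edgesI)
    then have "trans ?F Z a = Some (?ev `` {vertex_state y})"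
      using admissible_eventually_equal unfolding admissible_def
      by (intro quotient_automaton_trans) simp_all
    moreover have "trans ?C (?R `` {x'}) a = Some (?R `` {y})"
      by (rule quotient_automaton_trans[OF det[OF admissible_vertex_relation] quotient_edgesI[OF e(1)]])
    ultimately show ?thesis using g[OF x'(1)] g[OF x'(2)] Z' by simp
  qed
  ultimately show ?thesis
    unfolding automaton_iso_def F C
    by (intro exI[of _ g]) (simp add: quotient_automaton_def)
qed

end

section \<open>Local actions\<close>

lemma common_prefix_iff: "common_prefix u X \<longleftrightarrow> (\<forall>\<xi>\<in>X. initial (length u) \<xi> = u)"
  unfolding common_prefix_def using initial_eq_conc by (metis prefix_conc_length)

text \<open>Two members that differ right after \<open>u\<close> certify maximality, since any
  longer common prefix would fix that letter.\<close>

lemma greatest_common_prefix_eqI: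
  assumes u: "common_prefix u X" and split: "\<xi> \<in> X" "\<eta> \<in> X" "\<xi> (length u) \<noteq> \<eta> (length u)"
  shows "greatest_common_prefix X = u"
proof -
  have max: "Sublist.prefix v u" if v: "common_prefix v X" for v
  proof -
    obtain \<omega> \<omega>' where \<omega>: "\<xi> = u \<frown> \<omega>" "\<xi> = v \<frown> \<omega>'"
      using u v split(1) unfolding common_prefix_def by blast
    obtain \<zeta> where \<zeta>: "\<eta> = v \<frown> \<zeta>" using v split(2) unfolding common_prefix_def by blast
    have "\<not> length u < length v"
      using split(3) \<omega>(2) \<zeta> by auto
    moreover have "Sublist.prefix u v \<or> Sublist.prefix v u"
      using \<omega> conc_eq_comparable by metis
    ultimately show ?thesis
      by (auto simp: Sublist.prefix_def)
  qed
  show ?thesis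
    unfolding greatest_common_prefix_def
    by (rule the_equality) (use u max in \<open>blast intro: prefix_order.antisym\<close>)+
qed

lemma common_prefix_split_exists:
  assumes "\<xi> \<in> X" "\<eta> \<in> X" "\<xi> \<noteq> \<eta>"
  obtains u \<zeta> where "common_prefix u X" "\<zeta> \<in> X" "\<zeta> (length u) \<noteq> \<xi> (length u)"
proof -
  \<comment> \<open>The first position at which some member of \<open>X\<close> differs from
    \<open>\<xi>\<close>; before it all members agree.\<close>
  define k where "k = (LEAST k. \<exists>\<zeta>\<in>X. \<zeta> k \<noteq> \<xi> k)"
  obtain j where "\<exists>\<zeta>\<in>X. \<zeta> j \<noteq> \<xi> j" using assms by (metis ext)
  then have "\<exists>\<zeta>\<in>X. \<zeta> k \<noteq> \<xi> k" unfolding k_def by (rule LeastI)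
  then obtain \<zeta> where \<zeta>: "\<zeta> \<in> X" "\<zeta> k \<noteq> \<xi> k" by blast
  have "\<zeta>' i = \<xi> i" if "\<zeta>' \<in> X" "i < k" for \<zeta>' i
    using that not_less_Least[of i "\<lambda>k. \<exists>\<zeta>\<in>X. \<zeta> k \<noteq> \<xi> k"] unfolding k_def by blast
  then have "common_prefix (initial k \<xi>) X"
    unfolding common_prefix_iff by (auto intro: nth_equalityI)
  then show thesis using that[of "initial k \<xi>" \<zeta>] \<zeta> by simp
qed

text \<open>Says that the values of \<open>g\<close> have no common first letter. This is the normal
  form that distinguishes a local action from a map with output still to be split off.\<close>

definition separating :: "nat \<Rightarrow> ((nat \<Rightarrow> nat) \<Rightarrow> (nat \<Rightarrow> nat)) \<Rightarrow> bool" where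
  "separating m g \<longleftrightarrow> (\<exists>\<omega>\<in>cantor m. \<exists>\<omega>'\<in>cantor m. g \<omega> 0 \<noteq> g \<omega>' 0)"

text \<open>Any factorization with a separating tail is the local one. Later computations of
  \<open>\<theta>\<close> and of local actions exhibit such a factorization instead of arguing about
  greatest common prefixes.\<close>

lemma local_unique:
  assumes fg: "\<And>\<omega>. \<omega> \<in> cantor m \<Longrightarrow> f (x \<frown> \<omega>) = p \<frown> g \<omega>" and sep: "separating m g"
  shows "local_prefix m f x = p" and "local_action m f x = restrict g (cantor m)"
proof -
  obtain \<omega> \<omega>' where \<omega>: "\<omega> \<in> cantor m" "\<omega>' \<in> cantor m" "g \<omega> 0 \<noteq> g \<omega>' 0"
    using sep by (auto simp: separating_def)
  have "common_prefix p (f ` cylinder m x)"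
    using fg by (auto simp: common_prefix_def cylinder_def)
  moreover have "f (x \<frown> \<omega>) \<in> f ` cylinder m x" "f (x \<frown> \<omega>') \<in> f ` cylinder m x"
    using \<omega> by (auto simp: cylinder_def)
  moreover have "f (x \<frown> \<omega>) (length p) \<noteq> f (x \<frown> \<omega>') (length p)"
    using \<omega> fg by simp
  ultimately show p: "local_prefix m f x = p"
    unfolding local_prefix_def by (rule greatest_common_prefix_eqI)
  show "local_action m f x = restrict g (cantor m)"
    unfolding local_action_def p using fg by (auto simp: restrict_def fun_eq_iff)
qed

locale cantor_injection =
  fixes m n :: nat and f :: "(nat \<Rightarrow> nat) \<Rightarrow> (nat \<Rightarrow> nat)"
  assumes m: "2 \<le> m" and maps: "\<And>\<omega>. \<omega> \<in> cantor m \<Longrightarrow> f \<omega> \<in> cantor n"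
    and inj: "inj_on f (cantor m)"
begin

lemma local_split:
  assumes x: "x \<in> words m"
  obtains p g where "\<And>\<omega>. \<omega> \<in> cantor m \<Longrightarrow> f (x \<frown> \<omega>) = p \<frown> g \<omega>" "separating m g"
proof -
  let ?X = "f ` cylinder m x"
  have z: "(\<lambda>_. 0) \<in> cantor m" "(\<lambda>_. 1) \<in> cantor m" using m by (simp_all add: cantor_def)
  have "x \<frown> (\<lambda>_. 0) \<noteq> x \<frown> (\<lambda>_. 1)"
    by (simp only: same_concat_eq) (simp add: fun_eq_iff)
  then have "f (x \<frown> (\<lambda>_. 0)) \<noteq> f (x \<frown> (\<lambda>_. 1))"
    using inj_on_eq_iff[OF inj, of "x \<frown> (\<lambda>_. 0)" "x \<frown> (\<lambda>_. 1)"] x z by simp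
  moreover have "f (x \<frown> (\<lambda>_. 0)) \<in> ?X" "f (x \<frown> (\<lambda>_. 1)) \<in> ?X"
    using z by (auto simp: cylinder_def)
  ultimately obtain p \<zeta> where p: "common_prefix p ?X" and \<zeta>: "\<zeta> \<in> ?X"
    "\<zeta> (length p) \<noteq> f (x \<frown> (\<lambda>_. 0)) (length p)"
    using common_prefix_split_exists by metis
  define g where "g \<omega> = Omega_Words_Fun.suffix (length p) (f (x \<frown> \<omega>))" for \<omega>
  have "f (x \<frown> \<omega>) = p \<frown> g \<omega>" if "\<omega> \<in> cantor m" for \<omega>
    unfolding g_def
    by (rule initial_eq_conc) (use p that in \<open>auto simp: common_prefix_iff cylinder_def\<close>)
  moreover have "separating m g"
    using \<zeta> z unfolding separating_def g_def by (auto simp: cylinder_def)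
  ultimately show thesis by (rule that)
qed

lemma local_eq: "x \<in> words m \<Longrightarrow> \<omega> \<in> cantor m \<Longrightarrow>
    f (x \<frown> \<omega>) = local_prefix m f x \<frown> local_action m f x \<omega>"
  and local_separating: "x \<in> words m \<Longrightarrow> separating m (local_action m f x)"
proof -
  assume x: "x \<in> words m"
  obtain p g where pg: "\<And>\<omega>. \<omega> \<in> cantor m \<Longrightarrow> f (x \<frown> \<omega>) = p \<frown> g \<omega>" "separating m g"
    using local_split[OF x] by blast
  note * = local_unique[of m f x p g, OF pg]
  show "f (x \<frown> \<omega>) = local_prefix m f x \<frown> local_action m f x \<omega>" if "\<omega> \<in> cantor m"
    using pg(1)[OF that] that by (simp add: *)
  show "separating m (local_action m f x)"
    using pg(2) by (auto simp: * separating_def)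
qed

lemma local_in_words:
  assumes x: "x \<in> words m"
  shows "local_prefix m f x \<in> words n"
proof -
  have "(\<lambda>_. 0) \<in> cantor m" using zero_in_cantor[OF m] .
  then show ?thesis using local_eq[OF x] maps x by (metis conc_in_cantor)
qed

lemma local_in_cantor: "x \<in> words m \<Longrightarrow> \<omega> \<in> cantor m \<Longrightarrow> local_action m f x \<omega> \<in> cantor n"
  using local_eq maps by (metis conc_in_cantor)

lemma local_injection: "x \<in> words m \<Longrightarrow> cantor_injection m n (local_action m f x)"
proof
  assume x: "x \<in> words m"
  show "inj_on (local_action m f x) (cantor m)"
  proof (rule inj_onI)
    fix \<omega> \<eta> assume \<omega>: "\<omega> \<in> cantor m" "\<eta> \<in> cantor m" "local_action m f x \<omega> = local_action m f x \<eta>"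
    then have "f (x \<frown> \<omega>) = f (x \<frown> \<eta>)" using local_eq[OF x] by simp
    then have "x \<frown> \<omega> = x \<frown> \<eta>"
      using inj_on_eq_iff[OF inj, of "x \<frown> \<omega>" "x \<frown> \<eta>"] x \<omega>(1,2) by simp
    then show "\<omega> = \<eta>" by simp
  qed
qed (use m local_in_cantor in auto)

text \<open>Applying the local decomposition twice leaves a separating tail, so uniqueness
  identifies the outcome with the decomposition at \<open>x @ y\<close>.\<close>

lemma local_append:
  assumes x: "x \<in> words m" and y: "y \<in> words m"
  shows "local_prefix m f (x @ y) = local_prefix m f x @ local_prefix m (local_action m f x) y"
    and "local_action m f (x @ y) = local_action m (local_action m f x) y"
proof -
  interpret g: cantor_injection m n "local_action m f x" using local_injection[OF x] .
  have eq: "f ((x @ y) \<frown> \<omega>) = (local_prefix m f x @ local_prefix m (local_action m f x) y)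
      \<frown> local_action m (local_action m f x) y \<omega>" if "\<omega> \<in> cantor m" for \<omega>
    using local_eq[OF x, of "y \<frown> \<omega>"] g.local_eq[OF y that] y that by simp
  show "local_prefix m f (x @ y) = local_prefix m f x @ local_prefix m (local_action m f x) y"
    by (rule local_unique(1)[OF eq g.local_separating[OF y]])
  have "local_action m f (x @ y) = restrict (local_action m (local_action m f x) y) (cantor m)"
    by (rule local_unique(2)[OF eq g.local_separating[OF y]])
  then show "local_action m f (x @ y) = local_action m (local_action m f x) y"
    by (simp add: local_action_def)
qed

lemma local_prefix_greatest:
  assumes x: "x \<in> words m" and p: "\<And>\<omega>. \<omega> \<in> cantor m \<Longrightarrow> initial (length p) (f (x \<frown> \<omega>)) = p"
  obtains c where "local_prefix m f x = p @ c"
proof -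
  obtain \<omega> \<omega>' where \<omega>: "\<omega> \<in> cantor m" "\<omega>' \<in> cantor m" "local_action m f x \<omega> 0 \<noteq> local_action m f x \<omega>' 0"
    using local_separating[OF x] by (auto simp: separating_def)
  let ?q = "local_prefix m f x"
  have "length p \<le> length ?q"
  proof (rule ccontr)
    assume l: "\<not> length p \<le> length ?q"
    have *: "p ! length ?q = local_action m f x \<zeta> 0" if "\<zeta> \<in> cantor m" for \<zeta>
    proof -
      have "p = initial (length p) (?q \<frown> local_action m f x \<zeta>)"
        using p[OF that] local_eq[OF x that] by simp
      then have "p ! length ?q = (?q \<frown> local_action m f x \<zeta>) (length ?q)"
        using l subsequence_nth[of "length ?q" "length p" 0] by (metis add_0 diff_zero not_le)
      then show ?thesis by simp
    qed
    then show False using \<omega> by metis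
  qed
  moreover have "p = initial (length p) (?q \<frown> local_action m f x \<omega>)"
    using p[OF \<omega>(1)] local_eq[OF x \<omega>(1)] by simp
  ultimately have "p = take (length p) ?q" by simp
  then show thesis using that append_take_drop_id by metis
qed

end

lemma homeomorphism_injection:
  assumes "2 \<le> m" "homeomorphism (cantor m) (cantor n) f g"
  shows "cantor_injection m n f"
proof
  show "f \<omega> \<in> cantor n" if "\<omega> \<in> cantor m" for \<omega>
    using homeomorphism_image1[OF assms(2)] that by blast
  show "inj_on f (cantor m)"
    using homeomorphism_bij_betw[OF assms(2)] by (rule bij_betw_imp_inj_on)
qed (rule assms(1))

lemma local_Nil:
  assumes "separating m f" "f \<in> extensional (cantor m)"
  shows "local_prefix m f [] = []" "local_action m f [] = f"
  using local_unique[of m f "[]" "[]" f] assms by (simp_all add: extensional_restrict)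

section \<open>The inverse of a rational homeomorphism\<close>

text \<open>A long prefix of the image under \<open>\<psi>\<close> determines the first letter of
  the argument of the local action. At one point this is continuity of \<open>\<phi>\<close>; the
  fan theorem makes the length uniform, also near points outside the image of the local
  action.\<close>

lemma local_action_separates_uniformly:
  assumes hom: "homeomorphism (cantor n) (cantor m) \<psi> \<phi>" and n: "2 \<le> n" and u: "u \<in> words n"
  obtains N where "\<And>y \<zeta> \<zeta>'. y \<in> words m \<Longrightarrow> N \<le> length y \<Longrightarrow> \<zeta> \<in> cantor n \<Longrightarrow> \<zeta>' \<in> cantor n \<Longrightarrow>
    local_action n \<psi> u \<zeta> \<in> cylinder m y \<Longrightarrow> local_action n \<psi> u \<zeta>' \<in> cylinder m y \<Longrightarrow> \<zeta> 0 = \<zeta>' 0"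
proof -
  interpret \<psi>: cantor_injection n m \<psi> using homeomorphism_injection[OF n hom] .
  let ?g = "local_action n \<psi> u" and ?p = "local_prefix n \<psi> u"
  define Q where "Q y \<longleftrightarrow> (\<forall>\<zeta>\<in>cantor n. \<forall>\<zeta>'\<in>cantor n. initial (length y) (?g \<zeta>) = y \<longrightarrow>
      initial (length y) (?g \<zeta>') = y \<longrightarrow> \<zeta> 0 = \<zeta>' 0)" for y
  obtain N where N: "\<And>y. y \<in> words m \<Longrightarrow> N \<le> length y \<Longrightarrow> Q y"
  proof (rule cantor_fan[of m Q])
    fix \<omega> assume \<omega>: "\<omega> \<in> cantor m"
    have p: "?p \<frown> \<omega> \<in> cantor m" using \<omega> \<psi>.local_in_words[OF u] by simp
    have "continuous_on (cantor m) \<phi>" using hom by (simp add: homeomorphism_def)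
    \<comment> \<open>The first letter of \<open>\<zeta>\<close> stands at position
      \<open>length u\<close> of \<open>u \<frown> \<zeta>\<close>, hence the
      \<open>Suc\<close>.\<close>
    then obtain N where N: "\<And>\<eta>. \<eta> \<in> cantor m \<Longrightarrow> initial N \<eta> = initial N (?p \<frown> \<omega>) \<Longrightarrow>
        initial (Suc (length u)) (\<phi> \<eta>) = initial (Suc (length u)) (\<phi> (?p \<frown> \<omega>))"
      using continuous_on_cantor_initial[OF _ p] by metis
    have *: "\<zeta> 0 = \<phi> (?p \<frown> \<omega>) (length u)"
      if \<zeta>: "\<zeta> \<in> cantor n" "initial N (?g \<zeta>) = initial N \<omega>" for \<zeta>
    proof -
      have \<psi>: "\<psi> (u \<frown> \<zeta>) = ?p \<frown> ?g \<zeta>" using \<psi>.local_eq[OF u \<zeta>(1)] .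
      have "initial (length ?p + N) (?p \<frown> ?g \<zeta>) = initial (length ?p + N) (?p \<frown> \<omega>)"
        using \<zeta>(2) by simp
      then have "initial N (\<psi> (u \<frown> \<zeta>)) = initial N (?p \<frown> \<omega>)"
        unfolding \<psi> by (rule initial_mono_eq) simp
      then have "initial (Suc (length u)) (\<phi> (\<psi> (u \<frown> \<zeta>))) = initial (Suc (length u)) (\<phi> (?p \<frown> \<omega>))"
        using N \<psi>.maps u \<zeta>(1) by simp
      moreover have "\<phi> (\<psi> (u \<frown> \<zeta>)) = u \<frown> \<zeta>"
        using hom u \<zeta>(1) by (simp add: homeomorphism_def)
      ultimately have "initial (Suc (length u)) (u \<frown> \<zeta>) ! length u
          = initial (Suc (length u)) (\<phi> (?p \<frown> \<omega>)) ! length u"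
        by (simp only:)
      then show ?thesis by (simp only: subsequence_nth) simp
    qed
    have "Q (initial N \<omega>)"
      unfolding Q_def
    proof (intro ballI impI)
      fix \<zeta> \<zeta>' assume "\<zeta> \<in> cantor n" "\<zeta>' \<in> cantor n"
        "initial (length (initial N \<omega>)) (?g \<zeta>) = initial N \<omega>"
        "initial (length (initial N \<omega>)) (?g \<zeta>') = initial N \<omega>"
      then show "\<zeta> 0 = \<zeta>' 0" using *[of \<zeta>] *[of \<zeta>'] by simp
    qed
    then show "\<exists>k. Q (initial k \<omega>)" ..
  next
    fix w a assume "Q w"
    then show "Q (w @ [a])" unfolding Q_def by simp
  qed blast
  show thesis
  proof (rule that[of N])
    fix y \<zeta> \<zeta>' assume "y \<in> words m" "N \<le> length y" "\<zeta> \<in> cantor n" "\<zeta>' \<in> cantor n"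
      "?g \<zeta> \<in> cylinder m y" "?g \<zeta>' \<in> cylinder m y"
    then show "\<zeta> 0 = \<zeta>' 0" using N[of y] unfolding Q_def by (simp add: mem_cylinder_iff)
  qed
qed

text \<open>
  With \<open>u\<close> the greatest common prefix of \<open>\<phi>(U\<^sub>x)\<close>, one has \<open>x = \<theta>\<^sub>\<psi>(u) y\<close> with \<open>y\<close> of bounded
  length, and \<open>\<phi>\<^sub>x\<close> is determined by \<open>\<psi>\<^sub>u\<close> and \<open>y\<close>.
\<close>

lemma rational_inverse:
  assumes hom: "homeomorphism (cantor n) (cantor m) \<psi> \<phi>" and n: "2 \<le> n" and m: "2 \<le> m"
    and rat: "rational n \<psi>"
  shows "finite (local_action m \<phi> ` words m)"
proof -
  interpret \<psi>: cantor_injection n m \<psi> using homeomorphism_injection[OF n hom] .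
  interpret \<phi>: cantor_injection m n \<phi>
    using homeomorphism_injection[OF m homeomorphism_symD[OF hom]] .
  define G where "G = local_action n \<psi> ` words n"
  have "finite G" using rat by (simp add: G_def rational_def)
  define bound where "bound g N \<longleftrightarrow> (\<forall>y \<zeta> \<zeta>'. y \<in> words m \<longrightarrow> N \<le> length y \<longrightarrow> \<zeta> \<in> cantor n \<longrightarrow>
    \<zeta>' \<in> cantor n \<longrightarrow> g \<zeta> \<in> cylinder m y \<longrightarrow> g \<zeta>' \<in> cylinder m y \<longrightarrow> \<zeta> 0 = \<zeta>' 0)"
    for g :: "(nat \<Rightarrow> nat) \<Rightarrow> (nat \<Rightarrow> nat)" and N
  have "\<exists>N. bound g N" if "g \<in> G" for g
  proof -
    obtain u where "u \<in> words n" "g = local_action n \<psi> u" using \<open>g \<in> G\<close> by (auto simp: G_def)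
    then show ?thesis
      unfolding bound_def using local_action_separates_uniformly[OF hom n] by metis
  qed
  \<comment> \<open>The bound is attached to the function \<open>g\<close>, not to a word
    \<open>u\<close> with this local action; rationality of \<open>\<psi>\<close> then leaves only
    finitely many pairs \<open>(g, y)\<close>.\<close>
  then obtain N where N: "\<And>g. g \<in> G \<Longrightarrow> bound g (N g)" by metis
  let ?S = "SIGMA g:G. {y \<in> words m. length y \<le> N g}"
  let ?F = "\<lambda>(g, y). \<lambda>\<omega>\<in>cantor m. inv_into (cantor n) g (y \<frown> \<omega>)"
  have "{y \<in> words m. length y \<le> k} = {w. set w \<subseteq> {..<m} \<and> length w \<le> k}" for k
    by (auto simp: words_def lists_eq_set)
  then have "finite ?S" using \<open>finite G\<close> finite_lists_length_le[of "{..<m}"] by auto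
  moreover have "local_action m \<phi> x \<in> ?F ` ?S" if x: "x \<in> words m" for x
  proof -
    define u where "u = local_prefix m \<phi> x"
    define g where "g = local_action n \<psi> u"
    define p where "p = local_prefix n \<psi> u"
    have u: "u \<in> words n" unfolding u_def by (rule \<phi>.local_in_words[OF x])
    then have "g \<in> G" by (auto simp: g_def G_def)
    have eq: "x \<frown> \<omega> = p \<frown> g (local_action m \<phi> x \<omega>)" if \<omega>: "\<omega> \<in> cantor m" for \<omega>
    proof -
      have "x \<frown> \<omega> = \<psi> (\<phi> (x \<frown> \<omega>))" using hom x \<omega> by (simp add: homeomorphism_def)
      also have "\<dots> = \<psi> (u \<frown> local_action m \<phi> x \<omega>)"
        using \<phi>.local_eq[OF x \<omega>] by (simp add: u_def)
      also have "\<dots> = p \<frown> g (local_action m \<phi> x \<omega>)"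
        unfolding p_def g_def by (rule \<psi>.local_eq[OF u \<phi>.local_in_cantor[OF x \<omega>]])
      finally show ?thesis .
    qed
    have z: "(\<lambda>_. 0) \<in> cantor m" "(\<lambda>_. 1) \<in> cantor m" using m by (simp_all add: cantor_def)
    \<comment> \<open>Otherwise a letter of \<open>p\<close> would prescribe the first letter of
      every \<open>\<omega>\<close>.\<close>
    have "length p \<le> length x"
    proof (rule ccontr)
      assume "\<not> length p \<le> length x"
      then have "p ! length x = (x \<frown> \<omega>) (length x)" if "\<omega> \<in> cantor m" for \<omega>
        unfolding eq[OF that] by simp
      from this[OF z(1)] this[OF z(2)] show False by simp
    qed
    moreover have "Sublist.prefix p x \<or> Sublist.prefix x p"
      using conc_eq_comparable[OF eq[OF z(1)]] by blast
    ultimately obtain y where y: "x = p @ y" by (auto simp: Sublist.prefix_def)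
    have y_words: "y \<in> words m" using x y by simp
    have gy: "g (local_action m \<phi> x \<omega>) = y \<frown> \<omega>" if "\<omega> \<in> cantor m" for \<omega>
      using eq[OF that] unfolding y conc_conc[symmetric] same_concat_eq by simp
    obtain \<omega> \<omega>' where \<omega>: "\<omega> \<in> cantor m" "\<omega>' \<in> cantor m"
      "local_action m \<phi> x \<omega> 0 \<noteq> local_action m \<phi> x \<omega>' 0"
      using \<phi>.local_separating[OF x] by (auto simp: separating_def)
    \<comment> \<open>A longer \<open>y\<close> would force a common first letter on all values of
      the local action of \<open>\<phi>\<close> at \<open>x\<close>, although \<open>u\<close> was
      chosen as the full common prefix.\<close>
    have "length y \<le> N g"
    proof (rule ccontr)
      assume "\<not> length y \<le> N g"
      moreover have "g (local_action m \<phi> x \<omega>) \<in> cylinder m y" "g (local_action m \<phi> x \<omega>') \<in> cylinder m y"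
        using gy \<omega>(1,2) by (auto simp: cylinder_def)
      ultimately show False
        using N[OF \<open>g \<in> G\<close>] \<omega> y_words \<phi>.local_in_cantor[OF x] unfolding bound_def
        by (meson nle_le)
    qed
    moreover have "local_action m \<phi> x = ?F (g, y)"
    proof (rule extensionalityI[of _ "cantor m"])
      fix \<omega> assume \<omega>: "\<omega> \<in> cantor m"
      interpret g: cantor_injection n m g unfolding g_def by (rule \<psi>.local_injection[OF u])
      show "local_action m \<phi> x \<omega> = ?F (g, y) \<omega>"
        using \<omega> inv_into_f_f[OF g.inj \<phi>.local_in_cantor[OF x \<omega>]] gy[OF \<omega>] by simp
    qed (simp_all add: local_action_def)
    ultimately show ?thesis using \<open>g \<in> G\<close> y_words by blast
  qed
  ultimately show ?thesis by (meson finite_imageI finite_subset image_subsetI)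
qed

section \<open>The pullback automaton\<close>

lemma restrict_local_action: "restrict (local_action m f x) (cantor m) = local_action m f x"
  by (simp add: local_action_def)

lemma run_update_states [simp]: "run (B\<lparr>states := X\<rparr>) q w = run B q w"
  by (induction w arbitrary: q) auto

locale pullback_setting = A: full_automaton n A for n :: nat and A :: "'q automaton" +
  fixes m :: nat and \<psi> :: "(nat \<Rightarrow> nat) \<Rightarrow> (nat \<Rightarrow> nat)"
  assumes m: "2 \<le> m"
    and hom: "homeomorphism (cantor n) (cantor m) \<psi> (cantor_inverse n m \<psi>)"
    and mono: "monotone_on (cantor n) less_fun less_fun \<psi> \<or>
      monotone_on (cantor n) less_fun (\<lambda>x y. less_fun y x) \<psi>"
begin

abbreviation "\<phi> \<equiv> cantor_inverse n m \<psi>"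
abbreviation "\<theta> x \<equiv> local_prefix m \<phi> x"
abbreviation "act x \<equiv> local_action m \<phi> x"
abbreviation "B \<equiv> pullback n m \<psi> A"
abbreviation "conjugated h \<equiv> (\<lambda>\<omega>\<in>cantor m. \<psi> (h (\<phi> \<omega>)))"

sublocale \<phi>: cantor_injection m n \<phi>
  using homeomorphism_injection[OF m homeomorphism_symD[OF hom]] .

sublocale \<psi>: cantor_injection n m \<psi>
  using homeomorphism_injection[OF A.two_le hom] .

lemma \<phi>\<psi>: "\<omega> \<in> cantor n \<Longrightarrow> \<phi> (\<psi> \<omega>) = \<omega>"
  and \<psi>\<phi>: "\<omega> \<in> cantor m \<Longrightarrow> \<psi> (\<phi> \<omega>) = \<omega>"
  and continuous_\<psi>: "continuous_on (cantor n) \<psi>"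
  and continuous_\<phi>: "continuous_on (cantor m) \<phi>"
  using hom by (simp_all add: homeomorphism_def)

text \<open>\<open>\<phi>\<close> is onto, so it has values starting with 0 and with 1: nothing can
  be output before reading, and the root is consistent with the local action at the empty
  word.\<close>

lemma \<phi>_Nil: "\<theta> [] = []" "act [] = \<phi>"
proof -
  have "separating m \<phi>"
    unfolding separating_def
  proof (intro bexI)
    have "(\<lambda>_. 0) \<in> cantor n" "(\<lambda>_. 1) \<in> cantor n"
      using A.two_le by (simp_all add: cantor_def)
    then show "\<psi> (\<lambda>_. 0) \<in> cantor m" "\<psi> (\<lambda>_. 1) \<in> cantor m"
      "\<phi> (\<psi> (\<lambda>_. 0)) 0 \<noteq> \<phi> (\<psi> (\<lambda>_. 1)) 0"
      using \<psi>.maps \<phi>\<psi> by simp_all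
  qed
  moreover have "\<phi> \<in> extensional (cantor m)" by (simp add: cantor_inverse_def)
  ultimately show "\<theta> [] = []" "act [] = \<phi>" by (rule local_Nil)+
qed

text \<open>The product runs the transducer of \<open>\<phi>\<close> and feeds its output to
  \<open>A\<close>. By the rule for appended words the output produced so far is exactly
  \<open>\<theta> w\<close>.\<close>

lemma run_product:
  assumes "w \<in> words m"
  shows "run (product_automaton n m \<psi> A) (\<phi>, root A) w = Some (act w, A.state_of (\<theta> w))"
  using assms
proof (induction w rule: rev_induct)
  case Nil
  show ?case by (simp add: \<phi>_Nil)
next
  case (snoc a w)
  have w: "w \<in> words m" "[a] \<in> words m" using snoc.prems by auto
  interpret w: cantor_injection m n "act w" by (rule \<phi>.local_injection[OF w(1)])
  let ?p = "local_prefix m (act w) [a]"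
  have "run A (A.state_of (\<theta> w)) ?p = Some (A.dest (A.state_of (\<theta> w)) ?p)"
    using A.run_Some[OF A.dest_in_states[OF A.root_in_states \<phi>.local_in_words[OF w(1)]]
        w.local_in_words[OF w(2)]] by simp
  moreover have "A.dest (A.state_of (\<theta> w)) ?p = A.state_of (\<theta> (w @ [a]))"
    using A.dest_append[OF A.root_in_states \<phi>.local_in_words[OF w(1)]] \<phi>.local_append[OF w] by simp
  ultimately show ?case
    using snoc.IH[OF w(1)] \<phi>.local_append[OF w]
    by (simp add: run_append product_automaton_def)
qed

lemma root_pullback: "root B = (\<phi>, root A)"
  by (simp add: pullback_def reachable_part_def product_automaton_def)

lemma run_pullback: "w \<in> words m \<Longrightarrow> run B (root B) w = Some (act w, A.state_of (\<theta> w))"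
  using run_product unfolding root_pullback by (simp add: pullback_def reachable_part_def)

lemma states_pullback: "states B = (\<lambda>w. (act w, A.state_of (\<theta> w))) ` words m"
proof -
  have "root (product_automaton n m \<psi> A) = (\<phi>, root A)" by (simp add: product_automaton_def)
  then have "states B = {q \<in> states (product_automaton n m \<psi> A).
      \<exists>w\<in>words m. run (product_automaton n m \<psi> A) (\<phi>, root A) w = Some q}"
    by (simp add: pullback_def reachable_part_def)
  also have "\<dots> = {q \<in> states (product_automaton n m \<psi> A). \<exists>w\<in>words m. (act w, A.state_of (\<theta> w)) = q}"
    using run_product by auto
  also have "\<dots> = (\<lambda>w. (act w, A.state_of (\<theta> w))) ` words m"
  proof (intro equalityI subsetI)
    fix q assume "q \<in> (\<lambda>w. (act w, A.state_of (\<theta> w))) ` words m"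
    then obtain w where w: "w \<in> words m" "q = (act w, A.state_of (\<theta> w))" by blast
    then have "q \<in> states (product_automaton n m \<psi> A)"
      using A.dest_in_states[OF A.root_in_states \<phi>.local_in_words[OF w(1)]]
      by (simp add: product_automaton_def)
    with w show "q \<in> {q \<in> states (product_automaton n m \<psi> A).
        \<exists>w\<in>words m. (act w, A.state_of (\<theta> w)) = q}" by blast
  qed auto
  finally show ?thesis .
qed

lemma trans_pullback:
  assumes "w \<in> words m" "a < m"
  shows "trans B (act w, A.state_of (\<theta> w)) a = Some (act (w @ [a]), A.state_of (\<theta> (w @ [a])))"
proof -
  have "run B (root B) (w @ [a]) = Option.bind (run B (root B) w) (\<lambda>q. trans B q a)"
    by (simp add: run_append Option.bind_assoc cong: Option.bind_cong)
  then show ?thesis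
    using run_pullback[of w] run_pullback[of "w @ [a]"] assms by simp
qed

text \<open>Fullness is inherited: \<open>A\<close> can read whatever word the transducer
  outputs.\<close>

sublocale B: full_automaton m B
proof
  show "2 \<le> m" by (rule m)
  have root: "root B \<in> states B"
    unfolding states_pullback using \<phi>_Nil root_pullback by (intro image_eqI[of _ _ "[]"]) simp_all
  have "\<exists>w\<in>words m. run B (root B) w = Some q" if "q \<in> states B" for q
    using that run_pullback unfolding states_pullback by auto
  moreover have father: "father_state m B q" if "q \<in> states B" for q
    using that trans_pullback unfolding states_pullback by (auto simp: father_state_def)
  moreover have "q' \<in> states B" if q: "q \<in> states B" "a < m" "trans B q a = Some q'" for q a q'
  proof -
    obtain w where w: "w \<in> words m" "q = (act w, A.state_of (\<theta> w))"
      using q(1) unfolding states_pullback by blast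
    then have "q' = (act (w @ [a]), A.state_of (\<theta> (w @ [a])))"
      using trans_pullback[OF w(1) q(2)] q(3) by simp
    then show ?thesis unfolding states_pullback using w(1) q(2) by simp
  qed
  ultimately show "tree_automaton m B"
    unfolding tree_automaton_def using root by blast
  show "full m B" using father by (simp add: full_def)
qed

lemma same_state_pullback:
  assumes "x \<in> words m" "y \<in> words m"
  shows "same_state B x y \<longleftrightarrow> act x = act y \<and> A.state_of (\<theta> x) = A.state_of (\<theta> y)"
  using run_pullback assms by (auto simp: same_state_def)

lemma finite_states_pullback:
  assumes "rational n \<psi>" "finite (states A)"
  shows "finite (states B)"
proof -
  have "states B \<subseteq> (act ` words m) \<times> states A"
    using A.dest_in_states[OF A.root_in_states \<phi>.local_in_words]
    unfolding states_pullback by auto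
  then show ?thesis
    using rational_inverse[OF hom A.two_le m assms(1)] assms(2)
    by (meson finite_SigmaI finite_subset)
qed

text \<open>Around a point choose \<open>u\<close> so long that it extends a branch pair of the
  conjugate and \<open>\<phi>\<close> maps its cylinder into the source cylinder of an accepted pair
  of \<open>h\<close>. Computing \<open>\<phi>\<close> on the image cylinder then shows that both
  ends have the same local action and that \<open>A\<close> reaches the same state.\<close>

lemma conjugated_in_diagram_group:
  assumes h: "h \<in> diagram_group n A" and k: "conjugated h \<in> thompson m"
  shows "conjugated h \<in> diagram_group m B"
proof -
  have h_acc: "locally_accepted n (same_state A) h"
    using h by (rule A.diagram_group_locally_accepted)
  have "h \<in> thompson n" using h by (simp add: diagram_group_def)
  have "locally_accepted m (same_state B) (conjugated h)"
    unfolding locally_accepted_def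
  proof
    fix \<omega> assume \<omega>: "\<omega> \<in> cantor m"
    obtain u1 v1 \<eta>1 where u1: "u1 \<in> words m" "v1 \<in> words m" "\<eta>1 \<in> cantor m" "\<omega> = u1 \<frown> \<eta>1"
      "has_branch_pair m (conjugated h) u1 v1"
      using locally_acceptedE[OF thompson_locally_accepted[OF k] \<omega>] by blast
    obtain a b \<eta>2 where a: "a \<in> words n" "b \<in> words n" "\<eta>2 \<in> cantor n" "\<phi> \<omega> = a \<frown> \<eta>2"
      "has_branch_pair n h a b" "same_state A a b"
      using locally_acceptedE[OF h_acc \<phi>.maps[OF \<omega>]] .
    obtain N where N: "\<And>\<eta>. \<eta> \<in> cantor m \<Longrightarrow> initial N \<eta> = initial N \<omega> \<Longrightarrow>
        initial (length a) (\<phi> \<eta>) = initial (length a) (\<phi> \<omega>)"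
      using continuous_on_cantor_initial[OF continuous_\<phi> \<omega>] by metis
    \<comment> \<open>Adding \<open>N\<close> letters keeps the branch pair and makes
      \<open>u\<close> at least as long as the modulus of continuity of \<open>\<phi>\<close>
      requires.\<close>
    define e where "e = initial N \<eta>1"
    define \<eta> where "\<eta> = Omega_Words_Fun.suffix N \<eta>1"
    define u where "u = u1 @ e"
    define v where "v = v1 @ e"
    have e: "e \<in> words m" "\<eta> \<in> cantor m" using u1(3) by (simp_all add: e_def \<eta>_def)
    have uv: "u \<in> words m" "v \<in> words m" using u1 e by (simp_all add: u_def v_def)
    have \<omega>_eq: "\<omega> = u \<frown> \<eta>" using u1(4) by (simp add: u_def e_def \<eta>_def flip: conc_conc)
    have branch: "has_branch_pair m (conjugated h) u v"
      unfolding u_def v_def by (rule has_branch_pair_append[OF u1(5) e(1)])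
    have "initial (length a) (\<phi> (u \<frown> \<zeta>)) = a" if "\<zeta> \<in> cantor m" for \<zeta>
    proof -
      have "N \<le> length u" by (simp add: u_def e_def)
      then have "initial N (u \<frown> \<zeta>) = initial N \<omega>" unfolding \<omega>_eq by simp
      then show ?thesis using N[of "u \<frown> \<zeta>"] uv that a(4) by simp
    qed
    then obtain c where c: "\<theta> u = a @ c"
      using \<phi>.local_prefix_greatest[OF uv(1), of a] by blast
    have c_words: "c \<in> words n" using \<phi>.local_in_words[OF uv(1)] c by simp
    have "\<phi> (v \<frown> \<zeta>) = (b @ c) \<frown> act u \<zeta>" if \<zeta>: "\<zeta> \<in> cantor m" for \<zeta>
    proof -
      have "v \<frown> \<zeta> = \<psi> (h (\<phi> (u \<frown> \<zeta>)))"
        using has_branch_pairD[OF branch \<zeta>] uv \<zeta> by simp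
      then have "\<phi> (v \<frown> \<zeta>) = h (\<phi> (u \<frown> \<zeta>))"
        using \<phi>\<psi> thompson_in_cantor[OF \<open>h \<in> thompson n\<close> \<phi>.maps] uv \<zeta> by simp
      also have "\<dots> = h ((a @ c) \<frown> act u \<zeta>)"
        using \<phi>.local_eq[OF uv(1) \<zeta>] c by simp
      also have "\<dots> = (b @ c) \<frown> act u \<zeta>"
        using has_branch_pairD[OF has_branch_pair_append[OF a(5) c_words]]
          \<phi>.local_in_cantor[OF uv(1) \<zeta>] by blast
      finally show ?thesis .
    qed
    \<comment> \<open>\<open>\<phi>\<close> on the cylinder of \<open>v\<close> is now factored with
      the separating tail \<open>act u\<close>, so \<open>\<theta> v = b @ c\<close> and the two
      local actions coincide.\<close>
    note * = local_unique[of m \<phi> v "b @ c" "act u", OF this \<phi>.local_separating[OF uv(1)]]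
    have "act v = act u" using *(2) by (simp add: restrict_local_action)
    moreover have "A.state_of (\<theta> u) = A.state_of (\<theta> v)"
      using A.dest_append[OF A.root_in_states a(1), of c] A.dest_append[OF A.root_in_states a(2), of c]
        a(6) A.same_state_iff[OF a(1,2)] c *(1) by simp
    ultimately have "same_state B u v" using uv by (simp add: same_state_pullback)
    then show "\<exists>u\<in>words m. \<exists>v\<in>words m. \<exists>\<eta>\<in>cantor m. \<omega> = u \<frown> \<eta> \<and>
        has_branch_pair m (conjugated h) u v \<and> same_state B u v"
      using uv e(2) \<omega>_eq branch by blast
  qed
  then obtain d where "tree_diagram_of m (conjugated h) d" "\<And>u v. (u, v) \<in> set d \<Longrightarrow> same_state B u v"
    using locally_accepted_diagram[OF m thompson_bij[OF k] thompson_mono[OF k] _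
        B.right_invariant_same_state] by blast
  then show ?thesis using k by (auto simp: diagram_group_def accepted_def)
qed

text \<open>Here the conjugate back to \<open>cantor n\<close> is not known to lie in the Thompson
  group. Continuity, monotonicity and a diagram are all established, the diagram from accepted pairs
  around each point.\<close>

lemma diagram_group_pullback_subset:
  assumes g: "g \<in> diagram_group m B"
  obtains h where "h \<in> diagram_group n A" "g = conjugated h"
proof -
  have g_acc: "locally_accepted m (same_state B) g"
    using g by (rule B.diagram_group_locally_accepted)
  have "g \<in> thompson m" using g by (simp add: diagram_group_def)
  then obtain g' where g': "homeomorphism (cantor m) (cantor m) g g'" by (auto simp: thompson_def)
  define h where "h = (\<lambda>\<omega>\<in>cantor n. \<phi> (g (\<psi> \<omega>)))"
  have h_eq: "h \<omega> = \<phi> (g (\<psi> \<omega>))" if "\<omega> \<in> cantor n" for \<omega> using that by (simp add: h_def)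
  have g_cantor: "g \<omega> \<in> cantor m" if "\<omega> \<in> cantor m" for \<omega>
    using thompson_in_cantor[OF \<open>g \<in> thompson m\<close> that] .
  have h_hom: "homeomorphism (cantor n) (cantor n) h (\<phi> \<circ> (g' \<circ> \<psi>))"
    using homeomorphism_compose[OF homeomorphism_compose[OF hom g'] homeomorphism_symD[OF hom]]
    by (rule homeomorphism_cong) (simp_all add: h_def)
  have h_mono: "monotone_on (cantor n) less_fun less_fun h"
  proof (rule monotone_onI)
    fix x y assume xy: "x \<in> cantor n" "y \<in> cantor n" "less_fun x y"
    have \<psi>h: "\<psi> (h z) = g (\<psi> z)" "h z \<in> cantor n" if "z \<in> cantor n" for z
      using h_eq[OF that] \<psi>\<phi> g_cantor \<psi>.maps[OF that] \<phi>.maps by simp_all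
    note g_mono = monotone_onD[where f = g, OF thompson_mono[OF \<open>g \<in> thompson m\<close>]]
    show "less_fun (h x) (h y)"
      using mono
    proof
      assume *: "monotone_on (cantor n) less_fun less_fun \<psi>"
      have "less_fun (\<psi> x) (\<psi> y)" using * xy by (simp add: monotone_on_def)
      then have "less_fun (\<psi> (h x)) (\<psi> (h y))"
        using g_mono \<psi>.maps xy(1,2) \<psi>h(1) by simp
      then show ?thesis
        using monotone_on_reflect[OF * \<psi>h(2)[OF xy(1)] \<psi>h(2)[OF xy(2)]] less_fun_asym by metis
    next
      assume *: "monotone_on (cantor n) less_fun (\<lambda>x y. less_fun y x) \<psi>"
      have "less_fun (\<psi> y) (\<psi> x)" using * xy by (simp add: monotone_on_def)
      then have "less_fun (\<psi> (h y)) (\<psi> (h x))"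
        using g_mono \<psi>.maps xy(1,2) \<psi>h(1) by simp
      then show ?thesis
        using monotone_on_reflect[OF * \<psi>h(2)[OF xy(1)] \<psi>h(2)[OF xy(2)]] less_fun_asym by metis
    qed
  qed
  have "locally_accepted n (same_state A) h"
    unfolding locally_accepted_def
  proof
    fix \<omega> assume \<omega>: "\<omega> \<in> cantor n"
    obtain x y \<xi> where x: "x \<in> words m" "y \<in> words m" "\<xi> \<in> cantor m" "\<psi> \<omega> = x \<frown> \<xi>"
      "has_branch_pair m g x y" "same_state B x y"
      using locally_acceptedE[OF g_acc \<psi>.maps[OF \<omega>]] .
    have same: "act x = act y" "A.state_of (\<theta> x) = A.state_of (\<theta> y)"
      using x(6) same_state_pullback[OF x(1,2)] by simp_all
    have words: "\<theta> x \<in> words n" "\<theta> y \<in> words n" using \<phi>.local_in_words x(1,2) by simp_all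
    have \<omega>_eq: "\<omega> = \<theta> x \<frown> act x \<xi>"
      using \<phi>\<psi>[OF \<omega>] x(4) \<phi>.local_eq[OF x(1,3)] by simp
    obtain N where N: "\<And>\<eta>. \<eta> \<in> cantor n \<Longrightarrow> initial N \<eta> = initial N \<omega> \<Longrightarrow>
        initial (length x) (\<psi> \<eta>) = initial (length x) (\<psi> \<omega>)"
      using continuous_on_cantor_initial[OF continuous_\<psi> \<omega>] by metis
    \<comment> \<open>The image of the cylinder of \<open>x\<close> under \<open>\<phi>\<close> lies
      in that of \<open>\<theta> x\<close> but need not fill it. The extra word \<open>c\<close>
      shrinks the cylinder until \<open>\<psi>\<close> maps it into that of \<open>x\<close>, where
      \<open>g\<close> is known.\<close>
    define c where "c = initial N (act x \<xi>)"
    define \<eta> where "\<eta> = Omega_Words_Fun.suffix N (act x \<xi>)"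
    have c: "c \<in> words n" "\<eta> \<in> cantor n"
      using \<phi>.local_in_cantor[OF x(1,3)] by (simp_all add: c_def \<eta>_def)
    have \<omega>_eq': "\<omega> = (\<theta> x @ c) \<frown> \<eta>"
      using \<omega>_eq by (simp add: c_def \<eta>_def flip: conc_conc)
    have "has_branch_pair n h (\<theta> x @ c) (\<theta> y @ c)"
      unfolding has_branch_pair_def
    proof
      fix \<zeta> assume \<zeta>: "\<zeta> \<in> cantor n"
      let ?\<zeta> = "(\<theta> x @ c) \<frown> \<zeta>"
      have \<zeta>': "?\<zeta> \<in> cantor n" using \<zeta> words c by simp
      have "N \<le> length (\<theta> x @ c)" by (simp add: c_def)
      then have "initial N ?\<zeta> = initial N \<omega>" unfolding \<omega>_eq' by simp
      then have "initial (length x) (\<psi> ?\<zeta>) = x" using N[OF \<zeta>'] x(4) by simp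
      then obtain \<zeta>1 where \<zeta>1: "\<psi> ?\<zeta> = x \<frown> \<zeta>1" using initial_eq_conc by blast
      then have "\<zeta>1 \<in> cantor m" using \<psi>.maps[OF \<zeta>'] by simp
      then have "\<theta> x \<frown> (c \<frown> \<zeta>) = \<theta> x \<frown> act x \<zeta>1"
        using \<phi>\<psi>[OF \<zeta>'] \<zeta>1 \<phi>.local_eq[OF x(1)] by simp
      \<comment> \<open>The tail comes from a point of the cylinder of \<open>x\<close>; since the
        local actions at \<open>x\<close> and \<open>y\<close> agree, the same tail appears behind
        \<open>\<theta> y\<close>.\<close>
      then have act: "c \<frown> \<zeta> = act x \<zeta>1" unfolding same_concat_eq .
      have "h ?\<zeta> = \<phi> (y \<frown> \<zeta>1)"
        using h_eq[OF \<zeta>'] \<zeta>1 has_branch_pairD[OF x(5) \<open>\<zeta>1 \<in> cantor m\<close>] by simp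
      also have "\<dots> = \<theta> y \<frown> (c \<frown> \<zeta>)"
        using \<phi>.local_eq[OF x(2) \<open>\<zeta>1 \<in> cantor m\<close>] same(1) act by simp
      finally show "h ?\<zeta> = (\<theta> y @ c) \<frown> \<zeta>" by simp
    qed
    moreover have "same_state A (\<theta> x @ c) (\<theta> y @ c)"
      using words c same(2) A.dest_append[OF A.root_in_states words(1), of c]
        A.dest_append[OF A.root_in_states words(2), of c] by (simp add: A.same_state_iff)
    ultimately show "\<exists>u\<in>words n. \<exists>v\<in>words n. \<exists>\<eta>\<in>cantor n. \<omega> = u \<frown> \<eta> \<and>
        has_branch_pair n h u v \<and> same_state A u v"
      using words c \<omega>_eq' by (metis words_append)
  qed
  then obtain d where "tree_diagram_of n h d" "\<And>u v. (u, v) \<in> set d \<Longrightarrow> same_state A u v"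
    using locally_accepted_diagram[OF A.two_le homeomorphism_bij_betw[OF h_hom] h_mono _
        A.right_invariant_same_state] by blast
  moreover from this have "h \<in> thompson n"
    using h_hom h_mono by (auto simp: thompson_def h_def)
  ultimately have "h \<in> diagram_group n A" by (auto simp: diagram_group_def accepted_def)
  moreover have "g = conjugated h"
  proof (rule extensionalityI[OF thompson_extensional[OF \<open>g \<in> thompson m\<close>]])
    fix \<omega> assume \<omega>: "\<omega> \<in> cantor m"
    then show "g \<omega> = conjugated h \<omega>"
      using h_eq[OF \<phi>.maps[OF \<omega>]] \<psi>\<phi>[OF \<omega>] \<psi>\<phi>[OF g_cantor[OF \<omega>]] by simp
  qed simp
  ultimately show thesis by (rule that)
qed

lemma diagram_group_pullback:
  assumes "conjugate_group n m \<psi> (diagram_group n A) \<subseteq> thompson m"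
  shows "diagram_group m B = conjugate_group n m \<psi> (diagram_group n A)"
proof (intro equalityI subsetI)
  fix g assume "g \<in> diagram_group m B"
  then show "g \<in> conjugate_group n m \<psi> (diagram_group n A)"
    using diagram_group_pullback_subset unfolding conjugate_group_def by blast
next
  fix g assume g: "g \<in> conjugate_group n m \<psi> (diagram_group n A)"
  then obtain h where h: "h \<in> diagram_group n A" "g = conjugated h"
    unfolding conjugate_group_def by blast
  then show "g \<in> diagram_group m B"
    using conjugated_in_diagram_group[OF h(1)] assms g by blast
qed

lemma existence_property_pullback:
  assumes existence: "existence_property n A"
    and thompson: "conjugate_group n m \<psi> (diagram_group n A) \<subseteq> thompson m"
  shows "existence_property m B"
  unfolding existence_property_def
proof (intro ballI impI)
  fix x y assume xy: "x \<in> words m" "y \<in> words m" "same_state B x y"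
  have same: "act x = act y" "A.state_of (\<theta> x) = A.state_of (\<theta> y)"
    using xy(3) same_state_pullback[OF xy(1,2)] by simp_all
  have words: "\<theta> x \<in> words n" "\<theta> y \<in> words n" using \<phi>.local_in_words xy(1,2) by simp_all
  have "same_state A (\<theta> x) (\<theta> y)" using same(2) words by (simp add: A.same_state_iff)
  then obtain h where h: "h \<in> diagram_group n A" "has_branch_pair n h (\<theta> x) (\<theta> y)"
    using existence words unfolding existence_property_def by blast
  have "conjugated h \<in> diagram_group m B"
    using h(1) unfolding diagram_group_pullback[OF thompson] conjugate_group_def by blast
  moreover have "has_branch_pair m (conjugated h) x y"
    unfolding has_branch_pair_def
  proof
    fix \<omega> assume \<omega>: "\<omega> \<in> cantor m"
    have "conjugated h (x \<frown> \<omega>) = \<psi> (h (\<theta> x \<frown> act x \<omega>))"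
      using xy(1) \<omega> \<phi>.local_eq[OF xy(1) \<omega>] by simp
    also have "\<dots> = \<psi> (\<theta> y \<frown> act y \<omega>)"
      using has_branch_pairD[OF h(2) \<phi>.local_in_cantor[OF xy(1) \<omega>]] same(1) by simp
    also have "\<dots> = y \<frown> \<omega>"
      using \<phi>.local_eq[OF xy(2) \<omega>] \<psi>\<phi> xy(2) \<omega> by (metis conc_in_cantor)
    finally show "conjugated h (x \<frown> \<omega>) = y \<frown> \<omega>" .
  qed
  ultimately show "\<exists>f\<in>diagram_group m B. has_branch_pair m f x y" by blast
qed

end

theorem proposition5p6:
  fixes n m :: nat
    and \<psi> :: "(nat \<Rightarrow> nat) \<Rightarrow> (nat \<Rightarrow> nat)"
    and A :: "'q automaton"
    and H :: "((nat \<Rightarrow> nat) \<Rightarrow> (nat \<Rightarrow> nat)) set"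
  assumes "2 \<le> n" and "2 \<le> m"
    and "homeomorphism (cantor n) (cantor m) \<psi> (cantor_inverse n m \<psi>)"
    and "monotone_on (cantor n) less_fun less_fun \<psi> \<or>
         monotone_on (cantor n) less_fun (\<lambda>x y. less_fun y x) \<psi>"
    and "tree_automaton n A" and "full n A" and "existence_property n A"
    and "H = diagram_group n A"
    and "subgroup (conjugate_group n m \<psi> H) (thompson_group m)"
  shows "existence_property m (pullback n m \<psi> A) \<and>
         pre_core m (pullback n m \<psi> A) (conjugate_group n m \<psi> H) \<and>
         (\<forall>S T. rational n \<psi> \<longrightarrow> generates n S H \<longrightarrow> automaton_iso n A (core n S) \<longrightarrow>
            finite (states A) \<longrightarrow> generates m T (conjugate_group n m \<psi> H) \<longrightarrow>
            automaton_iso m (folded_quotient m (pullback n m \<psi> A)) (core m T))"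
proof -
  interpret pullback_setting n A m \<psi>
    using assms(1-6) by unfold_locales
  have thompson: "conjugate_group n m \<psi> (diagram_group n A) \<subseteq> thompson m"
    using subgroup.subset[OF assms(9)] assms(8) by (simp add: thompson_group_def)
  have group: "diagram_group m B = conjugate_group n m \<psi> H"
    unfolding assms(8) by (rule diagram_group_pullback[OF thompson])
  have existence: "existence_property m B"
    by (rule existence_property_pullback[OF assms(7) thompson])
  have "automaton_iso m (folded_quotient m B) (core m T)"
    if "rational n \<psi>" "finite (states A)" "generates m T (conjugate_group n m \<psi> H)" for T
  proof -
    interpret finite_pre_core m B T
      using existence finite_states_pullback[OF that(1,2)] that(3) group by unfold_locales simp_all
    show ?thesis by (rule folded_quotient_iso_core)
  qed
  then show ?thesis
    using existence group assms(9) B.tree unfolding pre_core_def by blast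
qed

end
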